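(* Consider an M/M/$m+$M queue with FCFS scheduling, arrival rate $\lambda$, $m\ge 1$ servers each of rate $\mu>0$, and abandonment rate $\theta>0$, under either DBS or DES. For $i\in\mathbb{Z}_+=\{0,1,2,\ldots\}$, let $p_{\mathrm{ab}}(i)$ be the probability that an arriving job finding $i$ jobs present abandons due to missing its deadline. Then $$p_{\mathrm{ab}}(i)=\frac{L(i+1)}{D(i+1)},\qquad i\in\mathbb{Z}_+,$$ where $L(i)=(i-m)^+\theta$ under DBS, $L(i)=i\theta$ under DES, and $D(i)=\min(i,m)\mu+L(i)$.
   Context: M/M/$m+$M queue: jobs arrive as a Poisson process of rate $\lambda$ to a node with $m$ identical servers, an unlimited buffer, and independent exponential service times of rate $\mu$; jobs are scheduled in first-come first-serve (FCFS) order. Each job has a relative deadline (time from arrival to deadline expiration) which is exponential with rate $\theta$, independent of everything else, and a job abandons the system immediately upon missing its deadline. Under DBS (deadline to the beginning of service) a job abandons if its deadline expires before its service starts (so jobs in service do not abandon); under DES (deadline to the end of service) a job abandons if its deadline expires before its service ends (so both waiting jobs and jobs in service may abandon). $L(i)$ is the total abandonment rate and $D(i)$ the total death (departure) rate when $i$ jobs are present; $x^+=\max(x,0)$. *)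

theory Defs
  imports "HOL-Probability.Probability"
begin

text \<open>
  \<open>DBS\<close>: deadline to the beginning of service; \<open>DES\<close>: deadline to the end of service.
\<close>

datatype deadline_type = DBS | DES

definition abandonment_rate :: "deadline_type \<Rightarrow> nat \<Rightarrow> real \<Rightarrow> nat \<Rightarrow> real" where
  "abandonment_rate c m \<theta> i =
     (case c of DBS \<Rightarrow> max (real i - real m) 0 * \<theta> | DES \<Rightarrow> real i * \<theta>)"

definition death_rate :: "deadline_type \<Rightarrow> nat \<Rightarrow> real \<Rightarrow> real \<Rightarrow> nat \<Rightarrow> real" where
  "death_rate c m \<mu> \<theta> i = real (min i m) * \<mu> + abandonment_rate c m \<theta> i"

text \<open>
  Sample paths. Jobs are numbered in order of arrival. The jobs \<open>0, \<dots>, q - 1\<close> are those present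
  at time 0, and the jobs \<open>q, q + 1, \<dots>\<close> arrive later: \<open>A q\<close> is the time until the first arrival
  and \<open>A k\<close>, for \<open>k > q\<close>, the time between the arrivals of the jobs \<open>k - 1\<close> and \<open>k\<close>.
  For \<open>n < q\<close> the sum below is empty.
\<close>

definition arrival_time :: "nat \<Rightarrow> (nat \<Rightarrow> real) \<Rightarrow> nat \<Rightarrow> real" where
  "arrival_time q A n = (\<Sum>k = q..n. A k)"

text \<open>
  In FCFS order the servers are always held by the jobs present with the smallest indices.
  Hence a job that never abandons enters service at the first moment at or after its arrival at
  which fewer than \<open>m\<close> of the earlier jobs are present, where \<open>a k\<close> and \<open>d k\<close> are the times at
  which job \<open>k\<close> arrives and leaves. Later jobs have no influence.
  The infimum is attained, since departed jobs are no longer counted at their departure time.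
\<close>

definition service_start :: "nat \<Rightarrow> (nat \<Rightarrow> real) \<Rightarrow> (nat \<Rightarrow> real) \<Rightarrow> nat \<Rightarrow> real" where
  "service_start m a d n = Inf {t. a n \<le> t \<and> card {k. k < n \<and> t < d k} < m}"

text \<open>
  Whether a job with absolute deadline \<open>e\<close>, service time \<open>s\<close> and (potential) service start \<open>b\<close>
  abandons.
\<close>

definition misses_deadline :: "deadline_type \<Rightarrow> real \<Rightarrow> real \<Rightarrow> real \<Rightarrow> bool" where
  "misses_deadline c b s e = (case c of DBS \<Rightarrow> e < b | DES \<Rightarrow> e < b + s)"

lemma service_start_cong [fundef_cong]:
  assumes "m = m'" "a = a'" "n = n'" "\<And>k. k < n' \<Longrightarrow> d k = d' k"
  shows "service_start m a d n = service_start m' a' d' n'"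
proof -
  have "{k. k < n \<and> t < d k} = {k. k < n' \<and> t < d' k}" for t
    using assms by auto
  then show ?thesis
    using assms by (simp add: service_start_def)
qed

text \<open>
  Here and below \<open>a\<close>, \<open>S\<close> and \<open>T\<close> are the arrival times, service times and relative deadlines.
\<close>

fun departure_time ::
  "deadline_type \<Rightarrow> nat \<Rightarrow> (nat \<Rightarrow> real) \<Rightarrow> (nat \<Rightarrow> real) \<Rightarrow> (nat \<Rightarrow> real) \<Rightarrow> nat \<Rightarrow> real" where
  "departure_time c m a S T n =
     (let b = service_start m a (\<lambda>k. departure_time c m a S T k) n
      in if misses_deadline c b (S n) (a n + T n) then a n + T n else b + S n)"

declare departure_time.simps [simp del]

definition abandons ::
  "deadline_type \<Rightarrow> nat \<Rightarrow> (nat \<Rightarrow> real) \<Rightarrow> (nat \<Rightarrow> real) \<Rightarrow> (nat \<Rightarrow> real) \<Rightarrow> nat \<Rightarrow> bool" where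
  "abandons c m a S T n =
     misses_deadline c (service_start m a (departure_time c m a S T) n) (S n) (a n + T n)"

definition jobs_found ::
  "deadline_type \<Rightarrow> nat \<Rightarrow> (nat \<Rightarrow> real) \<Rightarrow> (nat \<Rightarrow> real) \<Rightarrow> (nat \<Rightarrow> real) \<Rightarrow> nat \<Rightarrow> nat" where
  "jobs_found c m a S T n = card {k. k < n \<and> a n < departure_time c m a S T k}"

text \<open>
  The primitives of the queue: interarrival times, service times and relative deadlines, all
  mutually independent. Exponential interarrival times make the arrivals a Poisson process. By
  memorylessness, jobs present at time 0 are given fresh service times and deadlines.
\<close>

locale mmm_M_queue = prob_space M
  for M :: "'a measure" +
  fixes lambda \<mu> \<theta> :: real and m :: nat
    and A S T :: "nat \<Rightarrow> 'a \<Rightarrow> real"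
  assumes servers: "1 \<le> m"
    and rates: "0 < lambda" "0 < \<mu>" "0 < \<theta>"
    and interarrival: "\<And>k. distributed M lborel (A k) (exponential_density lambda)"
    and service: "\<And>k. distributed M lborel (S k) (exponential_density \<mu>)"
    and deadline: "\<And>k. distributed M lborel (T k) (exponential_density \<theta>)"
    and independent: "indep_vars (\<lambda>_. borel) (case_sum A (case_sum S T)) UNIV"

text \<open>
  \<open>p_ab c q n i\<close>: probability that the arriving job \<open>n\<close> abandons, given that it finds \<open>i\<close> jobs
  present, in the queue started with \<open>q\<close> jobs.
\<close>

definition (in mmm_M_queue) p_ab :: "deadline_type \<Rightarrow> nat \<Rightarrow> nat \<Rightarrow> nat \<Rightarrow> real" where
  "p_ab c q n i =
     cond_prob M
       (\<lambda>\<omega>. abandons c m (arrival_time q (\<lambda>k. A k \<omega>)) (\<lambda>k. S k \<omega>) (\<lambda>k. T k \<omega>) n)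
       (\<lambda>\<omega>. jobs_found c m (arrival_time q (\<lambda>k. A k \<omega>)) (\<lambda>k. S k \<omega>) (\<lambda>k. T k \<omega>) n = i)"

end

theory Submission
  imports Defs
begin

text \<open>
  While \<open>k\<close> earlier jobs are present, the next job leaves at rate \<open>\<theta>\<close> if \<open>k \<ge> m\<close>, and at rate \<open>\<nu>\<close>
  (\<open>\<mu>\<close> under \<open>DBS\<close>, \<open>\<mu> + \<theta>\<close> under \<open>DES\<close>) otherwise. The death rate \<open>D k\<close> is the sum of these
  hazards over the levels below \<open>k\<close>. By induction over the jobs, given that a job finds \<open>i\<close> jobs,
  the times until the next departures of these are independent with rates \<open>D i, \<dots>, D 1\<close>: the
  property survives the arrival of a job, whose departure splits one of the sojourn times, and it
  survives an independent exponential interarrival time. The potential waiting time \<open>b\<close> is the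
  total sojourn time at the levels \<open>m, \<dots>, i\<close>. The job meets its deadline with conditional
  probability \<open>exp (- \<theta> b)\<close>, times \<open>\<mu> / (\<mu> + \<theta>)\<close> under \<open>DES\<close>. Since \<open>D k + \<theta> = D (k + 1)\<close> for
  \<open>k \<ge> m\<close>, the product of the Laplace transforms \<open>D k / (D k + \<theta>)\<close> telescopes.
\<close>

section \<open>Exponential distributions\<close>

text \<open>In general the residual times of the jobs present are dependent and differ in law: a
  waiting job can leave only through its deadline, and its hazard changes when enough jobs ahead of
  it are gone. Sojourn times at the levels forget who leaves and keep only when someone leaves,
  which is all that a later job can notice. Since later jobs never influence earlier ones, the
  departures of all jobs found are already determined at an arrival. Joining is therefore the
  insertion of one point into a decreasing step function, a deterministic operation, and probability
  enters only through fresh exponential coordinates.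

  The law survives because of \<open>D (Suc k) = D k + hazard k\<close>: a new job and the next
  departure among \<open>k\<close> others are competing exponential clocks. Conditional laws are
  avoided by unnormalised weights: every statement is an \<open>ennreal\<close> integral of the
  indicator of finding \<open>i\<close> jobs times a product of test functions of single sojourn
  times. Levels of probability zero then need no special treatment, and positivity of the weight
  matters only in the final division.\<close>

definition exp_dist :: "real \<Rightarrow> real measure" where
  "exp_dist r = density lborel (exponential_density r)"

lemma sets_exp_dist [measurable_cong, simp]: "sets (exp_dist r) = sets borel"
  by (simp add: exp_dist_def)

lemma space_exp_dist [simp]: "space (exp_dist r) = UNIV"
  by (simp add: exp_dist_def)

lemma prob_space_exp_dist: "0 < r \<Longrightarrow> prob_space (exp_dist r)"
  unfolding exp_dist_def by (rule prob_space_exponential_density)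

lemma nn_integral_exp_dist:
  assumes [measurable]: "f \<in> borel_measurable borel"
  shows "(\<integral>\<^sup>+x. f x \<partial>exp_dist r) = (\<integral>\<^sup>+x. ennreal (exponential_density r x) * f x \<partial>lborel)"
  unfolding exp_dist_def by (rule nn_integral_density) auto

lemma emeasure_exp_dist_UNIV [simp]: "0 < r \<Longrightarrow> emeasure (exp_dist r) UNIV = 1"
  using prob_space.emeasure_space_1[OF prob_space_exp_dist] by simp

lemma AE_exp_dist_pos: "AE x in exp_dist r. 0 < x"
proof -
  have "AE x in lborel. x \<noteq> (0::real)"
    by (rule AE_lborel_singleton)
  then show ?thesis
    unfolding exp_dist_def by (subst AE_density) (auto simp: exponential_density_def)
qed

text \<open>Serves the indicators of \<open>{..<x}\<close> below, whose endpoint is itself a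
  variable of integration.\<close>

lemma measurable_pred_in_lessThan [measurable (raw)]:
  fixes f g :: "'a \<Rightarrow> real"
  assumes [measurable]: "f \<in> borel_measurable N" "g \<in> borel_measurable N"
  shows "Measurable.pred N (\<lambda>x. f x \<in> {..<g x})"
  by simp

text \<open>Memorylessness in integral form: with probability \<open>exp (- r * y)\<close> the clock
  survives \<open>y\<close>, and its excess over \<open>y\<close> is then a fresh clock. The proof
  substitutes \<open>y + x\<close> in the part beyond \<open>y\<close> and factors the
  density.\<close>

lemma nn_integral_exp_dist_split:
  assumes [measurable]: "G \<in> borel_measurable borel" and "0 < r" "0 \<le> y"
  shows "(\<integral>\<^sup>+x. G x \<partial>exp_dist r) =
    (\<integral>\<^sup>+x. G x * indicator {..<y} x \<partial>exp_dist r) + ennreal (exp (- r * y)) * (\<integral>\<^sup>+x. G (y + x) \<partial>exp_dist r)"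
proof -
  let ?d = "exponential_density r"
  have "(\<integral>\<^sup>+x. G x \<partial>exp_dist r) = (\<integral>\<^sup>+x. G x * indicator {..<y} x + G x * indicator {y..} x \<partial>exp_dist r)"
    by (intro nn_integral_cong) (auto simp: indicator_def)
  also have "\<dots> = (\<integral>\<^sup>+x. G x * indicator {..<y} x \<partial>exp_dist r) + (\<integral>\<^sup>+x. G x * indicator {y..} x \<partial>exp_dist r)"
    by (rule nn_integral_add) auto
  also have "(\<integral>\<^sup>+x. G x * indicator {y..} x \<partial>exp_dist r) = (\<integral>\<^sup>+x. ennreal (?d x) * (G x * indicator {y..} x) \<partial>lborel)"
    by (rule nn_integral_exp_dist) auto
  also have "\<dots> = (\<integral>\<^sup>+x. ennreal (?d (y + 1 * x)) * (G (y + 1 * x) * indicator {y..} (y + 1 * x)) \<partial>lborel)"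
    by (subst nn_integral_real_affine[where c=1 and t=y]) auto
  also have "\<dots> = (\<integral>\<^sup>+x. ennreal (exp (- r * y)) * (ennreal (?d x) * G (y + x)) \<partial>lborel)"
  proof (intro nn_integral_cong)
    fix x
    have "?d (y + x) = exp (- r * y) * ?d x" if "0 \<le> x"
      using that \<open>0 \<le> y\<close> by (simp add: exponential_density_def algebra_simps flip: exp_add)
    moreover have "?d x = 0" if "x < 0"
      using that by (simp add: exponential_density_def)
    ultimately show "ennreal (?d (y + 1 * x)) * (G (y + 1 * x) * indicator {y..} (y + 1 * x)) =
        ennreal (exp (- r * y)) * (ennreal (?d x) * G (y + x))"
      by (cases "0 \<le> x") (auto simp: ennreal_mult'' mult_ac)
  qed
  also have "\<dots> = ennreal (exp (- r * y)) * (\<integral>\<^sup>+x. G (y + x) \<partial>exp_dist r)"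
    by (subst nn_integral_cmult) (auto simp: nn_integral_exp_dist)
  finally show ?thesis .
qed

lemma nn_integral_exp_dist_split_lessThan:
  assumes [measurable]: "G \<in> borel_measurable borel" and "0 < r" "0 \<le> x" "0 \<le> y"
  shows "(\<integral>\<^sup>+u. G u * indicator {..<x + y} u \<partial>exp_dist r) =
    (\<integral>\<^sup>+u. G u * indicator {..<x} u \<partial>exp_dist r) +
    ennreal (exp (- r * x)) * (\<integral>\<^sup>+u. G (x + u) * indicator {..<y} u \<partial>exp_dist r)"
proof -
  have 1: "(\<lambda>u. G u * indicator {..<x + y} u * indicator {..<x} u) = (\<lambda>u. G u * indicator {..<x} u)"
    using \<open>0 \<le> y\<close> by (auto simp: indicator_def fun_eq_iff)
  have 2: "(\<lambda>u. G (x + u) * indicator {..<x + y} (x + u)) = (\<lambda>u. G (x + u) * indicator {..<y} u)"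
    by (auto simp: indicator_def fun_eq_iff)
  show ?thesis
    using nn_integral_exp_dist_split[of "\<lambda>u. G u * indicator {..<x + y} u" r x] assms
    unfolding 1 2 by simp
qed

lemma nn_integral_exp_dist_tail:
  assumes "0 < r" "0 \<le> y"
  shows "(\<integral>\<^sup>+x. indicator {y..} x \<partial>exp_dist r) = ennreal (exp (- r * y))"
proof -
  have "(\<integral>\<^sup>+x. indicator {y..} (y + x) \<partial>exp_dist r) = (\<integral>\<^sup>+x. 1 \<partial>exp_dist r)"
    using AE_exp_dist_pos[of r] by (intro nn_integral_cong_AE) auto
  moreover have "(\<lambda>x. indicator {y..} x * indicator {..<y} x :: ennreal) = (\<lambda>x. 0)"
    by (auto simp: indicator_def)
  ultimately show ?thesis
    using nn_integral_exp_dist_split[of "indicator {y..}" r y] assms by simp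
qed

text \<open>The factor \<open>exp (- h * x)\<close> is the probability that an independent clock of
  rate \<open>h\<close> outlasts \<open>x\<close>. It multiplies the density of rate
  \<open>r\<close> into a multiple of the density of rate \<open>r + h\<close>.\<close>

lemma nn_integral_exp_dist_tilt:
  assumes [measurable]: "f \<in> borel_measurable borel" and "0 < r" "0 \<le> h"
  shows "(\<integral>\<^sup>+x. ennreal (exp (- h * x)) * f x \<partial>exp_dist r) = ennreal (r / (r + h)) * (\<integral>\<^sup>+x. f x \<partial>exp_dist (r + h))"
proof -
  have "exponential_density r x * exp (- h * x) = r / (r + h) * exponential_density (r + h) x" for x
    using assms by (simp add: exponential_density_def field_simps flip: exp_add)
  then have "ennreal (exponential_density r x) * (ennreal (exp (- h * x)) * f x) =
      ennreal (r / (r + h)) * (ennreal (exponential_density (r + h) x) * f x)" for x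
    using assms by (simp flip: mult.assoc ennreal_mult'' ennreal_mult')
  then show ?thesis
    by (simp add: nn_integral_exp_dist nn_integral_cmult)
qed

text \<open>Competing clocks: \<open>v\<close> of rate \<open>h\<close> rings before
  \<open>x\<close> of rate \<open>r\<close> with probability \<open>h / (r + h)\<close>, and then
  \<open>v\<close> has rate \<open>r + h\<close> while the excess \<open>x - v\<close> is
  independent of it with rate \<open>r\<close> again. After exchanging the integrals, memorylessness
  is applied to \<open>x\<close> beyond \<open>v\<close>.\<close>

lemma nn_integral_exp_dist_conv:
  assumes [measurable]: "f \<in> borel_measurable borel" "g \<in> borel_measurable borel" and "0 < r" "0 < h"
  shows "(\<integral>\<^sup>+x. (\<integral>\<^sup>+v. f v * g (x - v) * indicator {..<x} v \<partial>exp_dist h) \<partial>exp_dist r) =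
    ennreal (h / (r + h)) * ((\<integral>\<^sup>+x. f x \<partial>exp_dist (r + h)) * (\<integral>\<^sup>+x. g x \<partial>exp_dist r))"
proof -
  interpret R: prob_space "exp_dist r" by (rule prob_space_exp_dist) fact
  interpret H: prob_space "exp_dist h" by (rule prob_space_exp_dist) fact
  interpret pair_sigma_finite "exp_dist h" "exp_dist r" ..
  have "(\<integral>\<^sup>+x. (\<integral>\<^sup>+v. f v * g (x - v) * indicator {..<x} v \<partial>exp_dist h) \<partial>exp_dist r)
      = (\<integral>\<^sup>+v. (\<integral>\<^sup>+x. f v * g (x - v) * indicator {..<x} v \<partial>exp_dist r) \<partial>exp_dist h)"
    by (rule Fubini') measurable
  also have "\<dots> = (\<integral>\<^sup>+v. ennreal (exp (- r * v)) * (f v * (\<integral>\<^sup>+x. g x \<partial>exp_dist r)) \<partial>exp_dist h)"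
  proof (rule nn_integral_cong_AE, use AE_exp_dist_pos[of h] in eventually_elim)
    fix v :: real assume "0 < v"
    have "(\<integral>\<^sup>+x. f v * g (x - v) * indicator {..<x} v \<partial>exp_dist r)
       = (\<integral>\<^sup>+x. (f v * g (x - v) * indicator {..<x} v) * indicator {..<v} x \<partial>exp_dist r) +
         ennreal (exp (- r * v)) * (\<integral>\<^sup>+x. f v * g (v + x - v) * indicator {..<v + x} v \<partial>exp_dist r)"
      using \<open>0 < v\<close> \<open>0 < r\<close> by (intro nn_integral_exp_dist_split) auto
    also have "(\<lambda>x. (f v * g (x - v) * indicator {..<x} v) * indicator {..<v} x) = (\<lambda>x. 0)"
      by (auto simp: indicator_def fun_eq_iff)
    also have "(\<integral>\<^sup>+x. f v * g (v + x - v) * indicator {..<v + x} v \<partial>exp_dist r) = (\<integral>\<^sup>+x. f v * g x \<partial>exp_dist r)"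
      using AE_exp_dist_pos[of r] by (intro nn_integral_cong_AE) auto
    also have "\<dots> = f v * (\<integral>\<^sup>+x. g x \<partial>exp_dist r)"
      by (rule nn_integral_cmult) simp
    finally show "(\<integral>\<^sup>+x. f v * g (x - v) * indicator {..<x} v \<partial>exp_dist r) =
        ennreal (exp (- r * v)) * (f v * (\<integral>\<^sup>+x. g x \<partial>exp_dist r))"
      by simp
  qed
  also have "\<dots> = ennreal (h / (h + r)) * (\<integral>\<^sup>+v. f v * (\<integral>\<^sup>+x. g x \<partial>exp_dist r) \<partial>exp_dist (h + r))"
    using assms by (intro nn_integral_exp_dist_tilt) auto
  also have "\<dots> = ennreal (h / (r + h)) * ((\<integral>\<^sup>+x. f x \<partial>exp_dist (r + h)) * (\<integral>\<^sup>+x. g x \<partial>exp_dist r))"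
    by (simp add: nn_integral_multc add.commute)
  finally show ?thesis .
qed

lemma nn_integral_exp_dist_min:
  assumes [measurable]: "G \<in> borel_measurable borel" and "0 < r" "0 < h"
  shows "(\<integral>\<^sup>+s. (\<integral>\<^sup>+t. G (min t s) \<partial>exp_dist h) \<partial>exp_dist r) = (\<integral>\<^sup>+x. G x \<partial>exp_dist (r + h))"
proof -
  have "(\<integral>\<^sup>+s. (\<integral>\<^sup>+t. G (min t s) \<partial>exp_dist h) \<partial>exp_dist r) =
     (\<integral>\<^sup>+s. (\<integral>\<^sup>+t. G t * 1 * indicator {..<s} t \<partial>exp_dist h) + ennreal (exp (- h * s)) * G s \<partial>exp_dist r)"
  proof (rule nn_integral_cong_AE, use AE_exp_dist_pos[of r] in eventually_elim)
    fix s :: real assume "0 < s"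
    have "(\<integral>\<^sup>+t. G (min t s) \<partial>exp_dist h) = (\<integral>\<^sup>+t. G (min t s) * indicator {..<s} t \<partial>exp_dist h) +
         ennreal (exp (- h * s)) * (\<integral>\<^sup>+t. G (min (s + t) s) \<partial>exp_dist h)"
      using \<open>0 < s\<close> \<open>0 < h\<close> by (intro nn_integral_exp_dist_split) auto
    also have "(\<lambda>t. G (min t s) * indicator {..<s} t) = (\<lambda>t. G t * 1 * indicator {..<s} t)"
      by (auto simp: indicator_def fun_eq_iff)
    also have "(\<integral>\<^sup>+t. G (min (s + t) s) \<partial>exp_dist h) = (\<integral>\<^sup>+t. G s \<partial>exp_dist h)"
      using AE_exp_dist_pos[of h] by (intro nn_integral_cong_AE) auto
    finally show "(\<integral>\<^sup>+t. G (min t s) \<partial>exp_dist h) =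
        (\<integral>\<^sup>+t. G t * 1 * indicator {..<s} t \<partial>exp_dist h) + ennreal (exp (- h * s)) * G s"
      using \<open>0 < h\<close> by simp
  qed
  also have "\<dots> = (\<integral>\<^sup>+s. (\<integral>\<^sup>+t. G t * 1 * indicator {..<s} t \<partial>exp_dist h) \<partial>exp_dist r) +
      (\<integral>\<^sup>+s. ennreal (exp (- h * s)) * G s \<partial>exp_dist r)"
  proof (rule nn_integral_add)
    interpret prob_space "exp_dist h" by (rule prob_space_exp_dist) fact
    show "(\<lambda>s. \<integral>\<^sup>+t. G t * 1 * indicator {..<s} t \<partial>exp_dist h) \<in> borel_measurable (exp_dist r)"
      by measurable
  qed simp
  also have "\<dots> = ennreal (h / (r + h)) * (\<integral>\<^sup>+x. G x \<partial>exp_dist (r + h)) +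
      ennreal (r / (r + h)) * (\<integral>\<^sup>+x. G x \<partial>exp_dist (r + h))"
    using nn_integral_exp_dist_conv[of G "\<lambda>_. 1" r h] nn_integral_exp_dist_tilt[of G r h] assms by simp
  also have "\<dots> = ennreal (h / (r + h) + r / (r + h)) * (\<integral>\<^sup>+x. G x \<partial>exp_dist (r + h))"
    using assms by (subst ennreal_plus) (auto simp: distrib_right)
  also have "h / (r + h) + r / (r + h) = 1"
    using assms by (simp flip: add_divide_distrib)
  finally show ?thesis by simp
qed

section \<open>Sojourn times\<close>

text \<open>
  A set of \<open>i\<close> jobs that will all leave is described by its sojourn times: \<open>\<tau> k\<close>, for \<open>1 \<le> k \<le> i\<close>,
  is the time during which exactly \<open>k\<close> of them are present. The values \<open>\<tau> k\<close> for other \<open>k\<close> are junk.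
\<close>

definition residual :: "deadline_type \<Rightarrow> real \<Rightarrow> real \<Rightarrow> real \<Rightarrow> real" where
  "residual c b s t = (if misses_deadline c b s t then t else b + s)"

text \<open>The levels are scanned from the top. If the new job leaves during the sojourn at level
  \<open>Suc i\<close>, that sojourn is cut at \<open>v\<close> and its first piece, when the new
  job is still there, moves up one level. Otherwise the whole sojourn moves up, and the search
  continues below with the time that is left.\<close>

fun insert_departure :: "nat \<Rightarrow> real \<Rightarrow> (nat \<Rightarrow> real) \<Rightarrow> nat \<Rightarrow> real" where
  "insert_departure 0 v \<tau> = \<tau>(1 := v)"
| "insert_departure (Suc i) v \<tau> =
    (if v < \<tau> (Suc i) then \<tau>(Suc (Suc i) := v, Suc i := \<tau> (Suc i) - v)
     else (insert_departure i (v - \<tau> (Suc i)) \<tau>)(Suc (Suc i) := \<tau> (Suc i)))"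

text \<open>The comparison is strict, so a job leaving exactly at time \<open>r\<close> is already
  gone, in agreement with the strict inequality in \<open>jobs_found\<close>.\<close>

fun advance :: "nat \<Rightarrow> real \<Rightarrow> (nat \<Rightarrow> real) \<Rightarrow> nat \<times> (nat \<Rightarrow> real)" where
  "advance 0 r \<tau> = (0, \<tau>)"
| "advance (Suc i) r \<tau> =
    (if r < \<tau> (Suc i) then (Suc i, \<tau>(Suc i := \<tau> (Suc i) - r)) else advance i (r - \<tau> (Suc i)) \<tau>)"

lemma pred_misses_deadline [measurable (raw)]:
  assumes [measurable]: "b \<in> borel_measurable N" "s \<in> borel_measurable N" "t \<in> borel_measurable N"
  shows "Measurable.pred N (\<lambda>\<omega>. misses_deadline c (b \<omega>) (s \<omega>) (t \<omega>))"
  by (cases c) (simp_all add: misses_deadline_def)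

lemma misses_deadline_shift: "misses_deadline c (x + b) s (x + t) = misses_deadline c b s t"
  by (cases c) (simp_all add: misses_deadline_def)

lemma measurable_residual [measurable (raw)]:
  assumes [measurable]: "b \<in> borel_measurable N" "s \<in> borel_measurable N" "t \<in> borel_measurable N"
  shows "(\<lambda>\<omega>. residual c (b \<omega>) (s \<omega>) (t \<omega>)) \<in> borel_measurable N"
  unfolding residual_def by measurable

lemma measurable_insert_departure [measurable (raw)]:
  assumes [measurable]: "\<And>k. (\<lambda>\<omega>. \<tau> \<omega> k) \<in> borel_measurable N" and "v \<in> borel_measurable N"
  shows "(\<lambda>\<omega>. insert_departure i (v \<omega>) (\<tau> \<omega>) k) \<in> borel_measurable N"
  using assms(2)
proof (induction i arbitrary: v k)
  case 0
  then show ?case by (cases "k = 1") simp_all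
next
  case (Suc i)
  note [measurable] = Suc.prems Suc.IH
  have "(\<lambda>\<omega>. if v \<omega> < \<tau> \<omega> (Suc i)
       then (if k = Suc i then \<tau> \<omega> (Suc i) - v \<omega> else if k = Suc (Suc i) then v \<omega> else \<tau> \<omega> k)
       else (if k = Suc (Suc i) then \<tau> \<omega> (Suc i) else insert_departure i (v \<omega> - \<tau> \<omega> (Suc i)) (\<tau> \<omega>) k))
    \<in> borel_measurable N"
    by measurable
  then show ?case
    by (rule back_subst[where P="\<lambda>f. f \<in> borel_measurable N"]) (auto simp: fun_eq_iff)
qed

lemma measurable_advance_fst [measurable (raw)]:
  assumes [measurable]: "\<And>k. (\<lambda>\<omega>. \<tau> \<omega> k) \<in> borel_measurable N" and "r \<in> borel_measurable N"
  shows "(\<lambda>\<omega>. fst (advance i (r \<omega>) (\<tau> \<omega>))) \<in> measurable N (count_space UNIV)"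
  using assms(2)
proof (induction i arbitrary: r)
  case (Suc i)
  note [measurable] = Suc.prems Suc.IH
  have "(\<lambda>\<omega>. if r \<omega> < \<tau> \<omega> (Suc i) then Suc i else fst (advance i (r \<omega> - \<tau> \<omega> (Suc i)) (\<tau> \<omega>)))
      \<in> measurable N (count_space UNIV)"
    by measurable
  then show ?case
    by (rule back_subst[where P="\<lambda>f. f \<in> measurable N (count_space UNIV)"]) (auto simp: fun_eq_iff)
qed simp

lemma measurable_advance_snd [measurable (raw)]:
  assumes [measurable]: "\<And>k. (\<lambda>\<omega>. \<tau> \<omega> k) \<in> borel_measurable N" and "r \<in> borel_measurable N"
  shows "(\<lambda>\<omega>. snd (advance i (r \<omega>) (\<tau> \<omega>)) k) \<in> borel_measurable N"
  using assms(2)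
proof (induction i arbitrary: r)
  case (Suc i)
  note [measurable] = Suc.prems Suc.IH
  have "(\<lambda>\<omega>. if r \<omega> < \<tau> \<omega> (Suc i) then (if k = Suc i then \<tau> \<omega> (Suc i) - r \<omega> else \<tau> \<omega> k)
       else snd (advance i (r \<omega> - \<tau> \<omega> (Suc i)) (\<tau> \<omega>)) k) \<in> borel_measurable N"
    by measurable
  then show ?case
    by (rule back_subst[where P="\<lambda>f. f \<in> borel_measurable N"]) (auto simp: fun_eq_iff)
qed simp

lemma insert_departure_nonneg:
  "\<lbrakk>\<And>k. 0 \<le> \<tau> k; 0 \<le> v\<rbrakk> \<Longrightarrow> 0 \<le> insert_departure i v \<tau> k"
  by (induction i arbitrary: v k) auto

lemma advance_nonneg: "(\<And>k. 0 \<le> \<tau> k) \<Longrightarrow> 0 \<le> snd (advance i r \<tau>) k"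
  by (induction i arbitrary: r) auto

lemma advance_le: "fst (advance i r \<tau>) \<le> i"
  by (induction i arbitrary: r) (auto intro: le_SucI)

lemma advance_pos: "0 < fst (advance i r \<tau>) \<Longrightarrow> 0 < snd (advance i r \<tau>) (fst (advance i r \<tau>))"
  by (induction i arbitrary: r) auto

lemma residual_nonneg: "\<lbrakk>0 \<le> b; 0 \<le> s; 0 \<le> t\<rbrakk> \<Longrightarrow> 0 \<le> residual c b s t"
  by (simp add: residual_def)

section \<open>Level rates and the law of the departure of a joining job\<close>

locale queue_rates =
  fixes c :: deadline_type and m :: nat and \<mu> \<theta> :: real
  assumes servers_pos: "1 \<le> m" and service_rate_pos: "0 < \<mu>" and deadline_rate_pos: "0 < \<theta>"
begin

definition \<nu> :: real where
  "\<nu> = (case c of DBS \<Rightarrow> \<mu> | DES \<Rightarrow> \<mu> + \<theta>)"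

definition hazard :: "nat \<Rightarrow> real" where
  "hazard k = (if k < m then \<nu> else \<theta>)"

abbreviation D :: "nat \<Rightarrow> real" where
  "D \<equiv> death_rate c m \<mu> \<theta>"

definition wait :: "nat \<Rightarrow> (nat \<Rightarrow> real) \<Rightarrow> real" where
  "wait i \<tau> = (\<Sum>k=m..i. \<tau> k)"

lemma nu_pos: "0 < \<nu>"
  using service_rate_pos deadline_rate_pos by (auto simp: \<nu>_def split: deadline_type.split)

lemma hazard_pos: "0 < hazard k"
  using nu_pos deadline_rate_pos by (simp add: hazard_def)

lemma D_0 [simp]: "D 0 = 0"
  by (cases c) (simp_all add: death_rate_def abandonment_rate_def)

text \<open>In FCFS order the last of \<open>k + 1\<close> jobs holds a server exactly if
  \<open>k < m\<close>; its own departure rate is what it adds to the total.\<close>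

lemma D_Suc: "D (Suc k) = D k + hazard k"
proof (cases "k < m")
  case True
  then show ?thesis
    by (simp add: death_rate_def abandonment_rate_def hazard_def \<nu>_def algebra_simps split: deadline_type.split)
next
  case False
  then show ?thesis
    by (simp add: death_rate_def abandonment_rate_def hazard_def algebra_simps split: deadline_type.split)
qed

lemma D_nonneg: "0 \<le> D k"
  by (induction k) (use hazard_pos in \<open>auto simp: D_Suc less_imp_le\<close>)

lemma D_Suc_pos: "0 < D (Suc k)"
  using D_nonneg[of k] hazard_pos[of k] by (simp add: D_Suc)

lemma D_pos: "0 < k \<Longrightarrow> 0 < D k"
  by (metis D_Suc_pos gr0_implies_Suc)

lemma measurable_wait [measurable (raw)]:
  assumes [measurable]: "\<And>k. (\<lambda>\<omega>. \<tau> \<omega> k) \<in> borel_measurable N"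
  shows "(\<lambda>\<omega>. wait i (\<tau> \<omega>)) \<in> borel_measurable N"
  unfolding wait_def by measurable

lemma wait_nonneg: "(\<And>k. 0 \<le> \<tau> k) \<Longrightarrow> 0 \<le> wait i \<tau>"
  by (simp add: wait_def sum_nonneg)

lemma wait_eq_0: "i < m \<Longrightarrow> wait i \<tau> = 0"
  by (simp add: wait_def)

lemma wait_Suc: "m \<le> Suc i \<Longrightarrow> wait (Suc i) \<tau> = \<tau> (Suc i) + wait i \<tau>"
  by (simp add: wait_def)

text \<open>During the potential wait \<open>b\<close> only the deadline can remove the job, so
  memorylessness at \<open>b\<close> separates the two summands. What follows is the service time
  under \<open>DBS\<close> and the minimum of service time and remaining deadline under
  \<open>DES\<close>; both are exponential of rate \<open>\<nu>\<close>.\<close>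

lemma nn_integral_residual:
  assumes [measurable]: "G \<in> borel_measurable borel" and b: "0 \<le> b"
  shows "(\<integral>\<^sup>+s. (\<integral>\<^sup>+t. G (residual c b s t) \<partial>exp_dist \<theta>) \<partial>exp_dist \<mu>) =
    (\<integral>\<^sup>+t. G t * indicator {..<b} t \<partial>exp_dist \<theta>) + ennreal (exp (- \<theta> * b)) * (\<integral>\<^sup>+r. G (b + r) \<partial>exp_dist \<nu>)"
proof -
  interpret T: prob_space "exp_dist \<theta>" by (rule prob_space_exp_dist) (rule deadline_rate_pos)
  define K where "K s = (\<integral>\<^sup>+t. G (residual c b s (b + t)) \<partial>exp_dist \<theta>)" for s
  have [measurable]: "K \<in> borel_measurable borel"
    unfolding K_def by measurable
  have "(\<integral>\<^sup>+s. (\<integral>\<^sup>+t. G (residual c b s t) \<partial>exp_dist \<theta>) \<partial>exp_dist \<mu>) =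
    (\<integral>\<^sup>+s. (\<integral>\<^sup>+t. G t * indicator {..<b} t \<partial>exp_dist \<theta>) + ennreal (exp (- \<theta> * b)) * K s \<partial>exp_dist \<mu>)"
  proof (rule nn_integral_cong_AE, use AE_exp_dist_pos[of \<mu>] in eventually_elim)
    fix s :: real assume "0 < s"
    have "(\<lambda>t. G (residual c b s t) * indicator {..<b} t) = (\<lambda>t. G t * indicator {..<b} t)"
      using \<open>0 < s\<close> by (cases c) (auto simp: residual_def misses_deadline_def indicator_def fun_eq_iff)
    then show "(\<integral>\<^sup>+t. G (residual c b s t) \<partial>exp_dist \<theta>) =
       (\<integral>\<^sup>+t. G t * indicator {..<b} t \<partial>exp_dist \<theta>) + ennreal (exp (- \<theta> * b)) * K s"
      using nn_integral_exp_dist_split[of "\<lambda>t. G (residual c b s t)" \<theta> b] b deadline_rate_pos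
      by (simp add: K_def)
  qed
  also have "\<dots> = (\<integral>\<^sup>+t. G t * indicator {..<b} t \<partial>exp_dist \<theta>) +
      ennreal (exp (- \<theta> * b)) * (\<integral>\<^sup>+s. K s \<partial>exp_dist \<mu>)"
    using service_rate_pos by (simp add: nn_integral_add nn_integral_cmult)
  also have "(\<integral>\<^sup>+s. K s \<partial>exp_dist \<mu>) = (\<integral>\<^sup>+r. G (b + r) \<partial>exp_dist \<nu>)"
  proof (cases c)
    case DBS
    have "K s = G (b + s)" for s
    proof -
      have "K s = (\<integral>\<^sup>+t. G (b + s) \<partial>exp_dist \<theta>)"
        unfolding K_def using AE_exp_dist_pos[of \<theta>]
        by (intro nn_integral_cong_AE) (auto simp: residual_def misses_deadline_def DBS)
      then show ?thesis using deadline_rate_pos by simp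
    qed
    moreover have "\<nu> = \<mu>" unfolding \<nu>_def by (simp add: DBS)
    ultimately show ?thesis by simp
  next
    case DES
    have "residual c b s (b + t) = b + min t s" for s t
      by (auto simp: residual_def misses_deadline_def DES min_def)
    moreover have "\<nu> = \<mu> + \<theta>" unfolding \<nu>_def by (simp add: DES)
    ultimately show ?thesis
      using nn_integral_exp_dist_min[of "\<lambda>r. G (b + r)" \<mu> \<theta>] service_rate_pos deadline_rate_pos
      by (simp add: K_def)
  qed
  finally show ?thesis .
qed

text \<open>
  While \<open>k\<close> earlier jobs are present, the next job leaves at rate \<open>hazard k\<close>. So its time to
  departure is governed by the hazards along the path of sojourn times.
\<close>

primrec hazard_integral :: "nat \<Rightarrow> (nat \<Rightarrow> real) \<Rightarrow> (real \<Rightarrow> ennreal) \<Rightarrow> ennreal" where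
  "hazard_integral 0 \<tau> G = (\<integral>\<^sup>+v. G v \<partial>exp_dist \<nu>)"
| "hazard_integral (Suc i) \<tau> G =
    (\<integral>\<^sup>+v. G v * indicator {..<\<tau> (Suc i)} v \<partial>exp_dist (hazard (Suc i))) +
    ennreal (exp (- hazard (Suc i) * \<tau> (Suc i))) * hazard_integral i \<tau> (\<lambda>v. G (\<tau> (Suc i) + v))"

text \<open>The hazard is \<open>\<theta>\<close> on all levels from \<open>m\<close> upwards, of
  total length \<open>wait i \<tau>\<close>, and \<open>\<nu>\<close> from there on. Memorylessness
  glues adjacent levels of equal hazard, so the level by level description agrees with the residual
  time, but now follows the recursion of \<open>insert_departure\<close>.\<close>

lemma hazard_integral_eq:
  assumes "\<And>k. 0 \<le> \<tau> k" and "G \<in> borel_measurable borel"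
  shows "hazard_integral i \<tau> G = (\<integral>\<^sup>+t. G t * indicator {..<wait i \<tau>} t \<partial>exp_dist \<theta>) +
    ennreal (exp (- \<theta> * wait i \<tau>)) * (\<integral>\<^sup>+r. G (wait i \<tau> + r) \<partial>exp_dist \<nu>)"
  using assms(2)
proof (induction i arbitrary: G)
  have zero: "(\<integral>\<^sup>+t. G t * indicator {..<0} t \<partial>exp_dist \<theta>) = 0" if "G \<in> borel_measurable borel" for G
  proof -
    have "(\<integral>\<^sup>+t. G t * indicator {..<0} t \<partial>exp_dist \<theta>) = (\<integral>\<^sup>+t. 0 \<partial>exp_dist \<theta>)"
      using AE_exp_dist_pos[of \<theta>] by (intro nn_integral_cong_AE) auto
    then show ?thesis by simp
  qed
  {
    case 0
    then show ?case using servers_pos by (simp add: wait_eq_0 zero)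
  next
    case (Suc i)
    note [measurable] = Suc.prems
    have IH: "hazard_integral i \<tau> (\<lambda>v. G (\<tau> (Suc i) + v)) =
        (\<integral>\<^sup>+t. G (\<tau> (Suc i) + t) * indicator {..<wait i \<tau>} t \<partial>exp_dist \<theta>) +
        ennreal (exp (- \<theta> * wait i \<tau>)) * (\<integral>\<^sup>+r. G (\<tau> (Suc i) + (wait i \<tau> + r)) \<partial>exp_dist \<nu>)"
      by (rule Suc.IH) simp
    show ?case
    proof (cases "Suc i < m")
      case True
      then show ?thesis
        using nn_integral_exp_dist_split[of G \<nu> "\<tau> (Suc i)"] nu_pos assms(1) IH
        by (simp add: wait_eq_0 zero hazard_def)
    next
      case False
      then have w: "wait (Suc i) \<tau> = \<tau> (Suc i) + wait i \<tau>" and h: "hazard (Suc i) = \<theta>"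
        by (simp_all add: wait_Suc hazard_def)
      have e: "exp (- \<theta> * (\<tau> (Suc i) + wait i \<tau>)) = exp (- \<theta> * \<tau> (Suc i)) * exp (- \<theta> * wait i \<tau>)"
        by (simp add: algebra_simps flip: exp_add)
      show ?thesis
        unfolding hazard_integral.simps IH w h e
        using nn_integral_exp_dist_split_lessThan[of G \<theta> "\<tau> (Suc i)" "wait i \<tau>"]
          assms(1) wait_nonneg[of \<tau> i] deadline_rate_pos
        by (simp add: ennreal_mult'' distrib_left mult.assoc add.assoc)
    qed
  }
qed

text \<open>For fixed sojourn times, the expected product of test functions after a random departure
  has been inserted; the two summands are the two cases of \<open>insert_departure\<close>. In the
  base case \<open>D 1\<close> equals \<open>\<nu>\<close>, since there is at least one
  server.\<close>

primrec inserted :: "(nat \<Rightarrow> real \<Rightarrow> ennreal) \<Rightarrow> nat \<Rightarrow> (nat \<Rightarrow> real) \<Rightarrow> ennreal" where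
  "inserted f 0 \<tau> = (\<integral>\<^sup>+v. f 1 v \<partial>exp_dist (D 1))"
| "inserted f (Suc i) \<tau> =
    (\<integral>\<^sup>+v. f (Suc (Suc i)) v * f (Suc i) (\<tau> (Suc i) - v) * indicator {..<\<tau> (Suc i)} v \<partial>exp_dist (hazard (Suc i)))
      * (\<Prod>k=1..i. f k (\<tau> k)) +
    ennreal (exp (- hazard (Suc i) * \<tau> (Suc i))) * f (Suc (Suc i)) (\<tau> (Suc i)) * inserted f i \<tau>"

lemma hazard_integral_cmult:
  assumes "\<And>k. 0 \<le> \<tau> k" and [measurable]: "G \<in> borel_measurable borel"
  shows "hazard_integral i \<tau> (\<lambda>v. a * G v) = a * hazard_integral i \<tau> G"
  using assms by (simp add: hazard_integral_eq nn_integral_cmult distrib_left mult.left_commute mult.assoc)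

text \<open>Restricting to positive \<open>v\<close> matters: at \<open>\<tau> (Suc i) + v\<close> a
  negative \<open>v\<close> would select the wrong branch of \<open>insert_departure\<close>, but
  such values form a null set.\<close>

lemma hazard_integral_cong:
  assumes "\<And>k. 0 \<le> \<tau> k" and "\<And>v. 0 < v \<Longrightarrow> F v = G v" 
  shows "hazard_integral i \<tau> F = hazard_integral i \<tau> G"
  using assms(2)
proof (induction i arbitrary: F G)
  case 0
  show ?case unfolding hazard_integral.simps using AE_exp_dist_pos[of \<nu>]
    by (intro nn_integral_cong_AE) (auto simp: 0)
next
  case (Suc i)
  have "hazard_integral i \<tau> (\<lambda>v. F (\<tau> (Suc i) + v)) = hazard_integral i \<tau> (\<lambda>v. G (\<tau> (Suc i) + v))"
    using assms(1)[of "Suc i"] by (intro Suc.IH Suc.prems) auto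
  moreover have "(\<integral>\<^sup>+v. F v * indicator {..<\<tau> (Suc i)} v \<partial>exp_dist (hazard (Suc i))) =
      (\<integral>\<^sup>+v. G v * indicator {..<\<tau> (Suc i)} v \<partial>exp_dist (hazard (Suc i)))"
    using AE_exp_dist_pos[of "hazard (Suc i)"] by (intro nn_integral_cong_AE) (auto simp: Suc.prems)
  ultimately show ?case by simp
qed

lemma hazard_integral_insert_departure:
  assumes nonneg: "\<And>k. 0 \<le> \<tau> k" and [measurable]: "\<And>k. f k \<in> borel_measurable borel"
  shows "hazard_integral i \<tau> (\<lambda>v. \<Prod>k=1..Suc i. f k (insert_departure i v \<tau> k)) = inserted f i \<tau>"
proof (induction i)
  case 0
  show ?case using servers_pos by (simp add: D_Suc hazard_def)
next
  case (Suc i)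
  let ?\<tau> = "\<tau> (Suc i)"
  have 1: "(\<Prod>k=1..Suc (Suc i). f k (insert_departure (Suc i) v \<tau> k)) =
      f (Suc (Suc i)) v * f (Suc i) (?\<tau> - v) * (\<Prod>k=1..i. f k (\<tau> k))" if "v < ?\<tau>" for v
  proof -
    have "(\<Prod>k=1..i. f k (insert_departure (Suc i) v \<tau> k)) = (\<Prod>k=1..i. f k (\<tau> k))"
      using that by (intro prod.cong) auto
    then show ?thesis using that by (simp add: mult_ac)
  qed
  have 2: "(\<Prod>k=1..Suc (Suc i). f k (insert_departure (Suc i) (?\<tau> + v) \<tau> k)) =
      f (Suc (Suc i)) ?\<tau> * (\<Prod>k=1..Suc i. f k (insert_departure i v \<tau> k))" if "0 < v" for v
  proof -
    have "(\<Prod>k=1..Suc i. f k (insert_departure (Suc i) (?\<tau> + v) \<tau> k)) =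
        (\<Prod>k=1..Suc i. f k (insert_departure i v \<tau> k))"
      using that by (intro prod.cong) auto
    then show ?thesis using that by (subst prod.nat_ivl_Suc') (auto simp: mult_ac)
  qed
  have "(\<integral>\<^sup>+v. (\<Prod>k=1..Suc (Suc i). f k (insert_departure (Suc i) v \<tau> k)) * indicator {..<?\<tau>} v \<partial>exp_dist (hazard (Suc i))) =
     (\<integral>\<^sup>+v. f (Suc (Suc i)) v * f (Suc i) (?\<tau> - v) * indicator {..<?\<tau>} v * (\<Prod>k=1..i. f k (\<tau> k)) \<partial>exp_dist (hazard (Suc i)))"
    by (intro nn_integral_cong) (simp add: 1 indicator_def del: insert_departure.simps prod.cl_ivl_Suc One_nat_def)
  also have "\<dots> = (\<integral>\<^sup>+v. f (Suc (Suc i)) v * f (Suc i) (?\<tau> - v) * indicator {..<?\<tau>} v \<partial>exp_dist (hazard (Suc i)))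
      * (\<Prod>k=1..i. f k (\<tau> k))"
    by (rule nn_integral_multc) simp
  finally have first: "(\<integral>\<^sup>+v. (\<Prod>k=1..Suc (Suc i). f k (insert_departure (Suc i) v \<tau> k)) * indicator {..<?\<tau>} v \<partial>exp_dist (hazard (Suc i))) = \<dots>" .
  have "hazard_integral i \<tau> (\<lambda>v. \<Prod>k=1..Suc (Suc i). f k (insert_departure (Suc i) (?\<tau> + v) \<tau> k)) =
      hazard_integral i \<tau> (\<lambda>v. f (Suc (Suc i)) ?\<tau> * (\<Prod>k=1..Suc i. f k (insert_departure i v \<tau> k)))"
    using nonneg 2 by (rule hazard_integral_cong)
  also have "\<dots> = f (Suc (Suc i)) ?\<tau> * inserted f i \<tau>"
    using nonneg by (subst hazard_integral_cmult) (simp_all add: Suc.IH del: prod.cl_ivl_Suc One_nat_def)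
  finally show ?case
    unfolding hazard_integral.simps inserted.simps first by (simp add: mult.assoc)
qed

end

lemma prod_split_atLeastAtMost:
  fixes F :: "nat \<Rightarrow> 'a::comm_monoid_mult"
  assumes "j \<le> i"
  shows "(\<Prod>k=1..i. F k) = (\<Prod>k=1..j. F k) * (\<Prod>k=Suc j..i. F k)"
  using prod.ub_add_nat[of 1 j F "i - j"] assms by simp

section \<open>Invariance of the joint law under a joining job and under elapsed time\<close>

context queue_rates
begin

lemma measurable_inserted [measurable (raw)]:
  assumes [measurable]: "\<And>k. f k \<in> borel_measurable borel" "\<And>k. (\<lambda>\<omega>. \<tau> \<omega> k) \<in> borel_measurable N"
  shows "(\<lambda>\<omega>. inserted f i (\<tau> \<omega>)) \<in> borel_measurable N"
proof (induction i)
  case (Suc i)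
  interpret prob_space "exp_dist (hazard (Suc i))"
    by (rule prob_space_exp_dist) (rule hazard_pos)
  note [measurable] = Suc
  show ?case unfolding inserted.simps by measurable
qed simp

text \<open>
  Under the weight \<open>g\<close>, the sojourn times at the levels \<open>1, \<dots>, i\<close> are independent and
  exponential with the death rates of the levels; \<open>a\<close> is the total weight.
\<close>

definition sojourn_law :: "'b measure \<Rightarrow> ('b \<Rightarrow> ennreal) \<Rightarrow> ('b \<Rightarrow> nat \<Rightarrow> real) \<Rightarrow> nat \<Rightarrow> ennreal \<Rightarrow> bool" where
  "sojourn_law N g \<tau> i a \<longleftrightarrow> (\<forall>f. (\<forall>k. f k \<in> borel_measurable borel) \<longrightarrow>
     (\<integral>\<^sup>+\<omega>. g \<omega> * (\<Prod>k=1..i. f k (\<tau> \<omega> k)) \<partial>N) = a * (\<Prod>k=1..i. \<integral>\<^sup>+x. f k x \<partial>exp_dist (D k)))"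

lemma sojourn_lawD:
  assumes "sojourn_law N g \<tau> i a" and "\<And>k. f k \<in> borel_measurable borel"
  shows "(\<integral>\<^sup>+\<omega>. g \<omega> * (\<Prod>k=1..i. f k (\<tau> \<omega> k)) \<partial>N) = a * (\<Prod>k=1..i. \<integral>\<^sup>+x. f k x \<partial>exp_dist (D k))"
  using assms by (simp add: sojourn_law_def)

text \<open>The levels above \<open>j\<close> carry arbitrary test functions \<open>p\<close>,
  because peeling off level \<open>Suc j\<close> leaves a tilted factor there, which the induction
  hypothesis must absorb. Level \<open>Suc j\<close> occurs in both products of the conclusion: the
  new job adds one level to those below the cut.\<close>

lemma nn_integral_inserted_aux:
  assumes law: "sojourn_law N g \<tau> i a"
    and [measurable]: "g \<in> borel_measurable N" "\<And>k. (\<lambda>\<omega>. \<tau> \<omega> k) \<in> borel_measurable N"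
      "\<And>k. f k \<in> borel_measurable borel"
    and "j \<le> i" and "\<And>k. p k \<in> borel_measurable borel"
  shows "(\<integral>\<^sup>+\<omega>. g \<omega> * (inserted f j (\<tau> \<omega>) * (\<Prod>k=Suc j..i. p k (\<tau> \<omega> k))) \<partial>N) =
    a * ((\<Prod>k=1..Suc j. \<integral>\<^sup>+x. f k x \<partial>exp_dist (D k)) * (\<Prod>k=Suc j..i. \<integral>\<^sup>+x. p k x \<partial>exp_dist (D k)))"
  using assms(5-)
proof (induction j arbitrary: p)
  case 0
  note [measurable] = 0(2)
  have "(\<integral>\<^sup>+\<omega>. g \<omega> * (inserted f 0 (\<tau> \<omega>) * (\<Prod>k=Suc 0..i. p k (\<tau> \<omega> k))) \<partial>N) =
     (\<integral>\<^sup>+\<omega>. (\<integral>\<^sup>+x. f 1 x \<partial>exp_dist (D 1)) * (g \<omega> * (\<Prod>k=1..i. p k (\<tau> \<omega> k))) \<partial>N)"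
    by (simp add: mult_ac)
  also have "\<dots> = (\<integral>\<^sup>+x. f 1 x \<partial>exp_dist (D 1)) * (a * (\<Prod>k=1..i. \<integral>\<^sup>+x. p k x \<partial>exp_dist (D k)))"
    by (subst nn_integral_cmult) (use sojourn_lawD[OF law, of p] in simp_all)
  finally show ?case by (simp add: mult_ac)
next
  case (Suc j)
  note [measurable] = Suc.prems(2)
  let ?E = "\<lambda>k F. \<integral>\<^sup>+x. F x \<partial>exp_dist (D k)"
  let ?h = "hazard (Suc j)"
  have h: "0 < ?h" "0 < D (Suc j)" by (rule hazard_pos, rule D_Suc_pos)
  interpret prob_space "exp_dist ?h"
    using h by (intro prob_space_exp_dist)
  \<comment> \<open>\<open>cv\<close> covers a departure of the new job within this sojourn, which
    is cut in two; \<open>tilt\<close> covers its survival of the whole sojourn, which then moves up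
    one level.\<close>
  define cv where "cv x = (\<integral>\<^sup>+v. f (Suc (Suc j)) v * f (Suc j) (x - v) * indicator {..<x} v \<partial>exp_dist ?h)" for x
  define tilt where "tilt x = ennreal (exp (- ?h * x)) * f (Suc (Suc j)) x" for x
  have [measurable]: "cv \<in> borel_measurable borel" "tilt \<in> borel_measurable borel"
    unfolding cv_def tilt_def by measurable
  \<comment> \<open>With \<open>p1\<close> the first case is a plain product, to which the law
    applies directly; with \<open>p2\<close> the second case is an instance of the induction
    hypothesis.\<close>
  define p1 where "p1 k = (if k \<le> j then f k else if k = Suc j then cv else p k)" for k
  define p2 where "p2 = p(Suc j := tilt)"
  have [measurable]: "p1 k \<in> borel_measurable borel" "p2 k \<in> borel_measurable borel" for k
    by (auto simp: p1_def p2_def)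
  \<comment> \<open>\<open>F\<close> is left general because the same factorisation is used twice:
    for values at the sojourn times and for expectations.\<close>
  have split1: "(\<Prod>k=1..i. F k (p1 k)) = (\<Prod>k=1..j. F k (f k)) * (F (Suc j) cv * (\<Prod>k=Suc (Suc j)..i. F k (p k)))"
    for F :: "nat \<Rightarrow> (real \<Rightarrow> ennreal) \<Rightarrow> ennreal"
  proof -
    have "(\<Prod>k=1..i. F k (p1 k)) = (\<Prod>k=1..j. F k (p1 k)) * (F (Suc j) (p1 (Suc j)) * (\<Prod>k=Suc (Suc j)..i. F k (p1 k)))"
      using Suc.prems by (subst prod_split_atLeastAtMost[of j]) (auto simp: prod.atLeast_Suc_atMost[of "Suc j"])
    also have "(\<Prod>k=Suc (Suc j)..i. F k (p1 k)) = (\<Prod>k=Suc (Suc j)..i. F k (p k))"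
      by (intro prod.cong) (auto simp: p1_def)
    finally show ?thesis by (simp add: p1_def)
  qed
  have split2: "(\<Prod>k=Suc j..i. F k (p2 k)) = F (Suc j) tilt * (\<Prod>k=Suc (Suc j)..i. F k (p k))"
    for F :: "nat \<Rightarrow> (real \<Rightarrow> ennreal) \<Rightarrow> ennreal"
  proof -
    have "(\<Prod>k=Suc (Suc j)..i. F k (p2 k)) = (\<Prod>k=Suc (Suc j)..i. F k (p k))"
      by (intro prod.cong) (auto simp: p2_def)
    then show ?thesis
      using Suc.prems by (simp add: prod.atLeast_Suc_atMost[of "Suc j"] p2_def)
  qed
  have "(\<integral>\<^sup>+\<omega>. g \<omega> * (inserted f (Suc j) (\<tau> \<omega>) * (\<Prod>k=Suc (Suc j)..i. p k (\<tau> \<omega> k))) \<partial>N) =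
      (\<integral>\<^sup>+\<omega>. g \<omega> * (\<Prod>k=1..i. p1 k (\<tau> \<omega> k)) +
        g \<omega> * (inserted f j (\<tau> \<omega>) * (\<Prod>k=Suc j..i. p2 k (\<tau> \<omega> k))) \<partial>N)"
    by (intro nn_integral_cong, subst split1[of "\<lambda>k F. F (\<tau> _ k)"], subst split2[of "\<lambda>k F. F (\<tau> _ k)"])
      (simp add: cv_def tilt_def distrib_left distrib_right mult_ac)
  also have "\<dots> = (\<integral>\<^sup>+\<omega>. g \<omega> * (\<Prod>k=1..i. p1 k (\<tau> \<omega> k)) \<partial>N) +
      (\<integral>\<^sup>+\<omega>. g \<omega> * (inserted f j (\<tau> \<omega>) * (\<Prod>k=Suc j..i. p2 k (\<tau> \<omega> k))) \<partial>N)"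
    by (rule nn_integral_add) measurable
  also have "\<dots> = a * (\<Prod>k=1..i. ?E k (p1 k)) +
      a * ((\<Prod>k=1..Suc j. ?E k (f k)) * (\<Prod>k=Suc j..i. ?E k (p2 k)))"
    using Suc.prems by (subst sojourn_lawD[OF law]; (subst Suc.IH)?) auto
  also have "\<dots> = a * ((\<Prod>k=1..j. ?E k (f k)) * (?E (Suc j) cv + ?E (Suc j) (f (Suc j)) * ?E (Suc j) tilt) *
      (\<Prod>k=Suc (Suc j)..i. ?E k (p k)))"
    unfolding split1[of ?E] split2[of ?E] by (simp add: distrib_left distrib_right mult_ac)
  \<comment> \<open>Whichever clock rings first, the first piece has rate
    \<open>D (Suc (Suc j))\<close> and the remainder is distributed as an independent sojourn at
    level \<open>Suc j\<close>. Both cases thus give the same product, and their probabilities add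
    up to 1.\<close>
  also have "?E (Suc j) cv + ?E (Suc j) (f (Suc j)) * ?E (Suc j) tilt =
      ?E (Suc j) (f (Suc j)) * ?E (Suc (Suc j)) (f (Suc (Suc j)))"
  proof -
    have cv: "?E (Suc j) cv = ennreal (?h / D (Suc (Suc j))) * (?E (Suc (Suc j)) (f (Suc (Suc j))) * ?E (Suc j) (f (Suc j)))"
      unfolding cv_def D_Suc[of "Suc j"] using h by (intro nn_integral_exp_dist_conv) auto
    have tilt: "?E (Suc j) tilt = ennreal (D (Suc j) / D (Suc (Suc j))) * ?E (Suc (Suc j)) (f (Suc (Suc j)))"
      unfolding tilt_def D_Suc[of "Suc j"] using h by (intro nn_integral_exp_dist_tilt) auto
    have "ennreal (?h / D (Suc (Suc j))) + ennreal (D (Suc j) / D (Suc (Suc j))) = 1"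
      using h D_Suc_pos[of "Suc j"]
      by (subst ennreal_plus[symmetric]) (auto simp: D_Suc[of "Suc j"] simp flip: add_divide_distrib)
    then have eq: "?E (Suc j) (f (Suc j)) * ?E (Suc (Suc j)) (f (Suc (Suc j))) =
        (ennreal (?h / D (Suc (Suc j))) + ennreal (D (Suc j) / D (Suc (Suc j)))) *
        (?E (Suc j) (f (Suc j)) * ?E (Suc (Suc j)) (f (Suc (Suc j))))"
      by simp
    show ?thesis
      unfolding cv tilt by (subst eq) (simp only: distrib_left distrib_right mult_ac)
  qed
  finally show ?case by (simp add: mult_ac)
qed

lemma nn_integral_inserted:
  assumes "sojourn_law N g \<tau> i a"
    and "g \<in> borel_measurable N" "\<And>k. (\<lambda>\<omega>. \<tau> \<omega> k) \<in> borel_measurable N"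
    and "\<And>k. f k \<in> borel_measurable borel"
  shows "(\<integral>\<^sup>+\<omega>. g \<omega> * inserted f i (\<tau> \<omega>) \<partial>N) = a * (\<Prod>k=1..Suc i. \<integral>\<^sup>+x. f k x \<partial>exp_dist (D k))"
  using nn_integral_inserted_aux[OF assms order.refl, of "\<lambda>_ _. 1"] by simp

text \<open>The counterpart of \<open>inserted\<close> for the passage of an exponential time of
  rate \<open>r\<close>: for fixed sojourn times, the expectation restricted to the event that
  exactly \<open>j\<close> jobs are left.\<close>

primrec advanced :: "real \<Rightarrow> nat \<Rightarrow> (nat \<Rightarrow> real \<Rightarrow> ennreal) \<Rightarrow> nat \<Rightarrow> (nat \<Rightarrow> real) \<Rightarrow> ennreal" where
  "advanced r j f 0 \<tau> = (if j = 0 then 1 else 0)"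
| "advanced r j f (Suc i) \<tau> =
    (if j = Suc i then (\<integral>\<^sup>+v. f (Suc i) (\<tau> (Suc i) - v) * indicator {..<\<tau> (Suc i)} v \<partial>exp_dist r) * (\<Prod>k=1..i. f k (\<tau> k))
     else 0) + ennreal (exp (- r * \<tau> (Suc i))) * advanced r j f i \<tau>"

lemma measurable_advanced [measurable (raw)]:
  assumes [measurable]: "\<And>k. f k \<in> borel_measurable borel" "\<And>k. (\<lambda>\<omega>. \<tau> \<omega> k) \<in> borel_measurable N"
    and "0 < r"
  shows "(\<lambda>\<omega>. advanced r j f i (\<tau> \<omega>)) \<in> borel_measurable N"
proof (induction i)
  case (Suc i)
  interpret prob_space "exp_dist r"
    using \<open>0 < r\<close> by (rule prob_space_exp_dist)
  note [measurable] = Suc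
  show ?case unfolding advanced.simps by measurable
qed simp

lemma nn_integral_advance:
  assumes nonneg: "\<And>k. 0 \<le> \<tau> k" and [measurable]: "\<And>k. f k \<in> borel_measurable borel" and r: "0 < r"
  shows "(\<integral>\<^sup>+v. indicator {j} (fst (advance i v \<tau>)) * (\<Prod>k=1..j. f k (snd (advance i v \<tau>) k)) \<partial>exp_dist r) =
    advanced r j f i \<tau>"
proof (induction i)
  case 0
  show ?case using r by simp
next
  case (Suc i)
  let ?G = "\<lambda>v. indicator {j} (fst (advance (Suc i) v \<tau>)) * (\<Prod>k=1..j. f k (snd (advance (Suc i) v \<tau>) k)) :: ennreal"
  let ?\<tau> = "\<tau> (Suc i)"
  have "?G v * indicator {..<?\<tau>} v = (if j = Suc i then f (Suc i) (?\<tau> - v) * indicator {..<?\<tau>} v * (\<Prod>k=1..i. f k (\<tau> k)) else 0)" for v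
  proof (cases "j = Suc i \<and> v < ?\<tau>")
    case True
    then have "(\<Prod>k=1..i. f k (snd (advance (Suc i) v \<tau>) k)) = (\<Prod>k=1..i. f k (\<tau> k))"
      by (intro prod.cong) auto
    then show ?thesis using True by (simp add: mult_ac)
  qed (auto simp: indicator_def)
  then have "(\<integral>\<^sup>+v. ?G v * indicator {..<?\<tau>} v \<partial>exp_dist r) =
     (if j = Suc i then (\<integral>\<^sup>+v. f (Suc i) (?\<tau> - v) * indicator {..<?\<tau>} v \<partial>exp_dist r) * (\<Prod>k=1..i. f k (\<tau> k)) else 0)"
    by (simp add: nn_integral_multc)
  moreover have "(\<integral>\<^sup>+v. ?G (?\<tau> + v) \<partial>exp_dist r) = advanced r j f i \<tau>"
    unfolding Suc.IH[symmetric] using AE_exp_dist_pos[of r] by (intro nn_integral_cong_AE) auto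
  moreover have "(\<integral>\<^sup>+v. ?G v \<partial>exp_dist r) = (\<integral>\<^sup>+v. ?G v * indicator {..<?\<tau>} v \<partial>exp_dist r) +
      ennreal (exp (- r * ?\<tau>)) * (\<integral>\<^sup>+v. ?G (?\<tau> + v) \<partial>exp_dist r)"
  proof (rule nn_integral_exp_dist_split)
    have 1: "(\<lambda>v. indicator {j} (fst (advance (Suc i) v \<tau>)) :: ennreal) \<in> borel_measurable borel"
      by (rule measurable_compose[OF measurable_advance_fst]) auto
    have 2: "(\<lambda>v. f k (snd (advance (Suc i) v \<tau>) k)) \<in> borel_measurable borel" for k
      by (rule measurable_compose[OF measurable_advance_snd]) auto
    show "?G \<in> borel_measurable borel"
      by (rule borel_measurable_times_ennreal[OF 1 borel_measurable_prod_ennreal[OF 2]])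
  qed (use nonneg r in auto)
  ultimately show ?case by simp
qed

text \<open>A pure death chain with rates \<open>D\<close>, started at the last argument and stopped
  by a clock of rate \<open>r\<close>: this is the probability of being stopped at level
  \<open>j\<close>. At level \<open>k\<close> the clock wins with probability
  \<open>r / (D k + r)\<close>.\<close>

primrec advance_prob :: "real \<Rightarrow> nat \<Rightarrow> nat \<Rightarrow> real" where
  "advance_prob r j 0 = (if j = 0 then 1 else 0)"
| "advance_prob r j (Suc i) = (if j = Suc i then r / (D (Suc i) + r) else 0) + D (Suc i) / (D (Suc i) + r) * advance_prob r j i"

lemma advance_prob_eq_0: "i < j \<Longrightarrow> advance_prob r j i = 0"
  by (induction i) auto

lemma advance_prob_nonneg: "0 < r \<Longrightarrow> 0 \<le> advance_prob r j i"
  by (induction i) (use D_Suc_pos in \<open>auto simp: less_imp_le\<close>)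

lemma advance_prob_pos: "\<lbrakk>0 < r; j \<le> i\<rbrakk> \<Longrightarrow> 0 < advance_prob r j i"
proof (induction i)
  case (Suc i)
  have "0 < D (Suc i)" by (rule D_Suc_pos)
  with Suc show ?case
    by (cases "j = Suc i") (auto simp: advance_prob_eq_0 intro!: divide_pos_pos mult_pos_pos)
qed simp

text \<open>The sojourn interrupted by the clock restarts afresh by memorylessness, and the lower
  ones are untouched. Hence the test functions factor out unchanged, and only the probability of
  stopping at level \<open>j\<close> remains. The functions \<open>p\<close> generalise the
  induction as in the case of insertion.\<close>

lemma nn_integral_advanced_aux:
  assumes law: "sojourn_law N g \<tau> i a"
    and [measurable]: "g \<in> borel_measurable N" "\<And>k. (\<lambda>\<omega>. \<tau> \<omega> k) \<in> borel_measurable N"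
      "\<And>k. f k \<in> borel_measurable borel"
    and r: "0 < r"
    and "l \<le> i" and "\<And>k. p k \<in> borel_measurable borel"
  shows "(\<integral>\<^sup>+\<omega>. g \<omega> * (advanced r j f l (\<tau> \<omega>) * (\<Prod>k=Suc l..i. p k (\<tau> \<omega> k))) \<partial>N) =
    a * (ennreal (advance_prob r j l) * (\<Prod>k=1..j. \<integral>\<^sup>+x. f k x \<partial>exp_dist (D k)) *
      (\<Prod>k=Suc l..i. \<integral>\<^sup>+x. p k x \<partial>exp_dist (D k)))"
  using assms(6-)
proof (induction l arbitrary: p)
  case 0
  then show ?case
    using sojourn_lawD[OF law, of p] by auto
next
  case (Suc l)
  note [measurable] = Suc.prems(2)
  let ?E = "\<lambda>k F. \<integral>\<^sup>+x. F x \<partial>exp_dist (D k)"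
  have D: "0 < D (Suc l)" by (rule D_Suc_pos)
  interpret prob_space "exp_dist r"
    using r by (rule prob_space_exp_dist)
  define cv where "cv x = (\<integral>\<^sup>+v. 1 * f (Suc l) (x - v) * indicator {..<x} v \<partial>exp_dist r)" for x
  define tilt where "tilt x = ennreal (exp (- r * x)) * 1" for x
  have [measurable]: "cv \<in> borel_measurable borel" "tilt \<in> borel_measurable borel"
    unfolding cv_def tilt_def by measurable
  define p1 where "p1 k = (if k \<le> l then f k else if k = Suc l then cv else p k)" for k
  define p2 where "p2 = p(Suc l := tilt)"
  have [measurable]: "p1 k \<in> borel_measurable borel" "p2 k \<in> borel_measurable borel" for k
    by (auto simp: p1_def p2_def)
  have split1: "(\<Prod>k=1..i. F k (p1 k)) = (\<Prod>k=1..l. F k (f k)) * (F (Suc l) cv * (\<Prod>k=Suc (Suc l)..i. F k (p k)))"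
    for F :: "nat \<Rightarrow> (real \<Rightarrow> ennreal) \<Rightarrow> ennreal"
  proof -
    have "(\<Prod>k=1..i. F k (p1 k)) = (\<Prod>k=1..l. F k (p1 k)) * (F (Suc l) (p1 (Suc l)) * (\<Prod>k=Suc (Suc l)..i. F k (p1 k)))"
      using Suc.prems by (subst prod_split_atLeastAtMost[of l]) (auto simp: prod.atLeast_Suc_atMost[of "Suc l"])
    also have "(\<Prod>k=Suc (Suc l)..i. F k (p1 k)) = (\<Prod>k=Suc (Suc l)..i. F k (p k))"
      by (intro prod.cong) (auto simp: p1_def)
    finally show ?thesis by (simp add: p1_def)
  qed
  have split2: "(\<Prod>k=Suc l..i. F k (p2 k)) = F (Suc l) tilt * (\<Prod>k=Suc (Suc l)..i. F k (p k))"
    for F :: "nat \<Rightarrow> (real \<Rightarrow> ennreal) \<Rightarrow> ennreal"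
  proof -
    have "(\<Prod>k=Suc (Suc l)..i. F k (p2 k)) = (\<Prod>k=Suc (Suc l)..i. F k (p k))"
      by (intro prod.cong) (auto simp: p2_def)
    then show ?thesis
      using Suc.prems by (simp add: prod.atLeast_Suc_atMost[of "Suc l"] p2_def)
  qed
  have cv: "?E (Suc l) cv = ennreal (r / (D (Suc l) + r)) * ?E (Suc l) (f (Suc l))"
    unfolding cv_def using D r by (subst nn_integral_exp_dist_conv) auto
  have tilt: "?E (Suc l) tilt = ennreal (D (Suc l) / (D (Suc l) + r))"
    unfolding tilt_def using D r by (subst nn_integral_exp_dist_tilt) auto
  have IH: "(\<integral>\<^sup>+\<omega>. g \<omega> * (advanced r j f l (\<tau> \<omega>) * (\<Prod>k=Suc l..i. p2 k (\<tau> \<omega> k))) \<partial>N) =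
     a * (ennreal (advance_prob r j l) * (\<Prod>k=1..j. ?E k (f k)) * (\<Prod>k=Suc l..i. ?E k (p2 k)))"
    using Suc.prems by (intro Suc.IH) auto
  show ?case
  proof (cases "j = Suc l")
    \<comment> \<open>Only the first summand contributes: once the count has dropped below
      \<open>Suc l\<close> it cannot return, so \<open>advance_prob r j l\<close> vanishes.\<close>
    case True
    have "(\<integral>\<^sup>+\<omega>. g \<omega> * (advanced r j f (Suc l) (\<tau> \<omega>) * (\<Prod>k=Suc (Suc l)..i. p k (\<tau> \<omega> k))) \<partial>N) =
        (\<integral>\<^sup>+\<omega>. g \<omega> * (\<Prod>k=1..i. p1 k (\<tau> \<omega> k)) +
          g \<omega> * (advanced r j f l (\<tau> \<omega>) * (\<Prod>k=Suc l..i. p2 k (\<tau> \<omega> k))) \<partial>N)"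
      by (intro nn_integral_cong, subst split1[of "\<lambda>k F. F (\<tau> _ k)"], subst split2[of "\<lambda>k F. F (\<tau> _ k)"])
        (simp add: True cv_def tilt_def distrib_left distrib_right mult_ac)
    also have "\<dots> = (\<integral>\<^sup>+\<omega>. g \<omega> * (\<Prod>k=1..i. p1 k (\<tau> \<omega> k)) \<partial>N) +
        (\<integral>\<^sup>+\<omega>. g \<omega> * (advanced r j f l (\<tau> \<omega>) * (\<Prod>k=Suc l..i. p2 k (\<tau> \<omega> k))) \<partial>N)"
      using r by (intro nn_integral_add) measurable
    also have "\<dots> = a * (\<Prod>k=1..i. ?E k (p1 k))"
      unfolding IH by (subst sojourn_lawD[OF law]) (auto simp: True advance_prob_eq_0)
    finally show ?thesis
      unfolding split1[of ?E] cv by (simp add: True advance_prob_eq_0 mult_ac)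
  next
    case False
    have "(\<integral>\<^sup>+\<omega>. g \<omega> * (advanced r j f (Suc l) (\<tau> \<omega>) * (\<Prod>k=Suc (Suc l)..i. p k (\<tau> \<omega> k))) \<partial>N) =
        (\<integral>\<^sup>+\<omega>. g \<omega> * (advanced r j f l (\<tau> \<omega>) * (\<Prod>k=Suc l..i. p2 k (\<tau> \<omega> k))) \<partial>N)"
      by (intro nn_integral_cong, subst split2[of "\<lambda>k F. F (\<tau> _ k)"])
        (simp add: False tilt_def mult_ac)
    also note IH
    moreover have "ennreal (advance_prob r j (Suc l)) = ennreal (D (Suc l) / (D (Suc l) + r)) * ennreal (advance_prob r j l)"
      using False advance_prob_nonneg[OF r] D r by (simp flip: ennreal_mult)
    ultimately show ?thesis
      unfolding split2[of ?E] tilt by (simp only: mult_ac)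
  qed
qed

lemma nn_integral_advanced:
  assumes "sojourn_law N g \<tau> i a"
    and "g \<in> borel_measurable N" "\<And>k. (\<lambda>\<omega>. \<tau> \<omega> k) \<in> borel_measurable N"
    and "\<And>k. f k \<in> borel_measurable borel" and "0 < r"
  shows "(\<integral>\<^sup>+\<omega>. g \<omega> * advanced r j f i (\<tau> \<omega>) \<partial>N) =
    a * ennreal (advance_prob r j i) * (\<Prod>k=1..j. \<integral>\<^sup>+x. f k x \<partial>exp_dist (D k))"
  using nn_integral_advanced_aux[OF assms order.refl, of "\<lambda>_ _. 1" j] by (simp add: mult.assoc)

end

section \<open>Sample paths\<close>

text \<open>The number of earlier jobs still to leave is a decreasing, right-continuous step
  function of time, so the infimum is attained. Sublevel sets of the service start thereby become
  conditions on a count.\<close>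

lemma service_start_le_iff:
  assumes m: "1 \<le> m"
  shows "service_start m a d n \<le> x \<longleftrightarrow> a n \<le> x \<and> card {k. k < n \<and> x < d k} < m"
proof -
  let ?C = "\<lambda>t. {k. k < n \<and> t < d k}"
  let ?S = "{t. a n \<le> t \<and> card (?C t) < m}"
  have fin [simp]: "finite (?C t)" for t by simp
  have "\<exists>t\<ge>a n. \<forall>k<n. d k \<le> t"
  proof (intro exI conjI allI impI)
    show "a n \<le> max (a n) (Max (d ` {..<n}))" by simp
    show "d k \<le> max (a n) (Max (d ` {..<n}))" if "k < n" for k
      using that by (simp add: le_max_iff_disj)
  qed
  then obtain t0 where "a n \<le> t0" "\<And>k. k < n \<Longrightarrow> d k \<le> t0" by blast
  then have "?C t0 = {}" by force
  then have ne: "?S \<noteq> {}" using m \<open>a n \<le> t0\<close> by (metis (mono_tags, lifting) card.empty empty_iff less_le_trans mem_Collect_eq zero_less_one)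
  have bdd: "bdd_below ?S" by (auto simp: bdd_below_def)
  show ?thesis
  proof
    assume "a n \<le> x \<and> card (?C x) < m"
    then show "service_start m a d n \<le> x"
      unfolding service_start_def by (intro cInf_lower bdd) auto
  next
    assume le: "service_start m a d n \<le> x"
    have "a n \<le> service_start m a d n"
      unfolding service_start_def by (rule cInf_greatest[OF ne]) auto
    moreover have "card (?C x) < m"
    proof (rule ccontr)
      assume "\<not> ?thesis"
      then have many: "m \<le> card (?C x)" by simp
      have "?C x \<noteq> {}"
      proof
        assume "?C x = {}"
        then have "card (?C x) = 0" by (simp only: card.empty)
        then show False using many m by linarith
      qed
      \<comment> \<open>The next departure after \<open>x\<close>. Before \<open>y\<close> at least
        as many earlier jobs are present as at \<open>x\<close>, hence no service start is possible
        there.\<close>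
      define y where "y = Min (d ` ?C x)"
      have y: "x < y" "\<And>k. k \<in> ?C x \<Longrightarrow> y \<le> d k"
        unfolding y_def using \<open>?C x \<noteq> {}\<close> by (subst Min_gr_iff) auto
      have "y \<le> service_start m a d n"
        unfolding service_start_def
      proof (rule cInf_greatest[OF ne], rule ccontr)
        fix t assume t: "t \<in> ?S" "\<not> y \<le> t"
        then have "?C x \<subseteq> ?C t" using y by force
        then have "card (?C x) \<le> card (?C t)" by (intro card_mono fin)
        then show False using many t by simp
      qed
      then show False using le y by simp
    qed
    ultimately show "a n \<le> x \<and> card (?C x) < m" using le by simp
  qed
qed

text \<open>As a finite sum of indicators the count is accessible to measurability
  arguments.\<close>

lemma real_card_later:
  fixes d :: "nat \<Rightarrow> real"
  shows "real (card {k. k < n \<and> x < d k}) = (\<Sum>k<n. if x < d k then 1 else 0)"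
proof (induction n)
  case (Suc n)
  have "{k. k < Suc n \<and> x < d k} = (if x < d n then insert n else id) {k. k < n \<and> x < d k}"
    by (auto simp: less_Suc_eq)
  with Suc show ?case by simp
qed simp

lemma card_later_Suc:
  fixes d :: "nat \<Rightarrow> real"
  shows "card {k. k < Suc n \<and> x < d k} = card {k. k < n \<and> x < d k} + (if x < d n then 1 else 0)"
proof -
  have "real (card {k. k < Suc n \<and> x < d k}) = real (card {k. k < n \<and> x < d k} + (if x < d n then 1 else 0))"
    by (simp add: real_card_later)
  then show ?thesis by (simp only: of_nat_eq_iff)
qed

lemma measurable_arrival_time [measurable (raw)]:
  assumes [measurable]: "\<And>k. A k \<in> borel_measurable N"
  shows "(\<lambda>\<omega>. arrival_time q (\<lambda>k. A k \<omega>) n) \<in> borel_measurable N"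
  unfolding arrival_time_def by measurable

lemma measurable_service_start:
  assumes [measurable]: "\<And>k. k < n \<Longrightarrow> (\<lambda>\<omega>. d \<omega> k) \<in> borel_measurable N" "(\<lambda>\<omega>. a \<omega> n) \<in> borel_measurable N"
    and m: "1 \<le> m"
  shows "(\<lambda>\<omega>. service_start m (a \<omega>) (d \<omega>) n) \<in> borel_measurable N"
proof -
  have "service_start m (a \<omega>) (d \<omega>) n \<le> x \<longleftrightarrow> a \<omega> n \<le> x \<and> (\<Sum>k<n. if x < d \<omega> k then 1 else 0) < real m" for \<omega> x
    unfolding service_start_le_iff[OF m] real_card_later[symmetric] by simp
  then show ?thesis
    unfolding borel_measurable_iff_le by simp
qed

lemma measurable_departure_time:
  assumes [measurable]: "\<And>k. (\<lambda>\<omega>. a \<omega> k) \<in> borel_measurable N" "\<And>k. S k \<in> borel_measurable N" "\<And>k. T k \<in> borel_measurable N"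
    and m: "1 \<le> m"
  shows "(\<lambda>\<omega>. departure_time c m (a \<omega>) (\<lambda>k. S k \<omega>) (\<lambda>k. T k \<omega>) n) \<in> borel_measurable N"
proof (induction n rule: less_induct)
  case (less n)
  have [measurable]: "(\<lambda>\<omega>. service_start m (a \<omega>) (departure_time c m (a \<omega>) (\<lambda>k. S k \<omega>) (\<lambda>k. T k \<omega>)) n) \<in> borel_measurable N"
    using less m by (intro measurable_service_start) auto
  show ?case
    by (subst departure_time.simps) (simp add: Let_def)
qed

lemma pred_abandons:
  assumes [measurable]: "\<And>k. (\<lambda>\<omega>. a \<omega> k) \<in> borel_measurable N" "\<And>k. S k \<in> borel_measurable N" "\<And>k. T k \<in> borel_measurable N"
    and m: "1 \<le> m"
  shows "Measurable.pred N (\<lambda>\<omega>. abandons c m (a \<omega>) (\<lambda>k. S k \<omega>) (\<lambda>k. T k \<omega>) n)"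
proof -
  have [measurable]: "(\<lambda>\<omega>. service_start m (a \<omega>) (departure_time c m (a \<omega>) (\<lambda>k. S k \<omega>) (\<lambda>k. T k \<omega>)) n) \<in> borel_measurable N"
    using m by (intro measurable_service_start measurable_departure_time) auto
  show ?thesis
    unfolding abandons_def by measurable
qed

lemma pred_jobs_found:
  assumes [measurable]: "\<And>k. (\<lambda>\<omega>. a \<omega> k) \<in> borel_measurable N" "\<And>k. S k \<in> borel_measurable N" "\<And>k. T k \<in> borel_measurable N"
    and m: "1 \<le> m"
  shows "Measurable.pred N (\<lambda>\<omega>. jobs_found c m (a \<omega>) (\<lambda>k. S k \<omega>) (\<lambda>k. T k \<omega>) n = i)"
proof -
  note [measurable] = measurable_departure_time[OF assms]
  have "(jobs_found c m (a \<omega>) (\<lambda>k. S k \<omega>) (\<lambda>k. T k \<omega>) n = i) \<longleftrightarrow>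
      (\<Sum>k<n. if a \<omega> n < departure_time c m (a \<omega>) (\<lambda>k. S k \<omega>) (\<lambda>k. T k \<omega>) k then 1 else 0) = real i" for \<omega>
    unfolding jobs_found_def real_card_later[symmetric] by simp
  then show ?thesis by simp
qed

section \<open>The remaining count as a step function of time\<close>

fun present :: "nat \<Rightarrow> (nat \<Rightarrow> real) \<Rightarrow> real \<Rightarrow> nat" where
  "present 0 \<tau> u = 0"
| "present (Suc i) \<tau> u = (if u < \<tau> (Suc i) then Suc i else present i \<tau> (u - \<tau> (Suc i)))"

lemma present_cong: "(\<And>k. k \<le> i \<Longrightarrow> \<tau> k = \<sigma> k) \<Longrightarrow> present i \<tau> u = present i \<sigma> u"
  by (induction i arbitrary: u) auto

lemma present_upd [simp]: "i < k \<Longrightarrow> present i (\<tau>(k := x)) u = present i \<tau> u"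
  by (rule present_cong) auto

text \<open>Correctness of the insertion: the step function is raised by one exactly until the new
  departure.\<close>

lemma present_insert_departure:
  "present (Suc i) (insert_departure i v \<tau>) u = present i \<tau> u + (if u < v then 1 else 0)"
proof (induction i arbitrary: u v)
  case (Suc i)
  show ?case
  proof (cases "v < \<tau> (Suc i)")
    case True
    then show ?thesis by (auto intro!: present_cong)
  next
    case False
    define \<sigma> where "\<sigma> = insert_departure i (v - \<tau> (Suc i)) \<tau>"
    have "present (Suc (Suc i)) (insert_departure (Suc i) v \<tau>) u =
       (if u < \<tau> (Suc i) then Suc (Suc i) else present (Suc i) (\<sigma>(Suc (Suc i) := \<tau> (Suc i))) (u - \<tau> (Suc i)))"
      using False by (simp add: \<sigma>_def)
    also have "present (Suc i) (\<sigma>(Suc (Suc i) := \<tau> (Suc i))) (u - \<tau> (Suc i)) = present (Suc i) \<sigma> (u - \<tau> (Suc i))"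
      by (rule present_upd) simp
    also have "\<dots> = present i \<tau> (u - \<tau> (Suc i)) + (if u < v then 1 else 0)"
      unfolding \<sigma>_def Suc.IH by simp
    finally show ?thesis
      using False by simp
  qed
qed simp

lemma present_advance:
  "0 \<le> u \<Longrightarrow> present (fst (advance i r \<tau>)) (snd (advance i r \<tau>)) u = present i \<tau> (r + u)"
  by (induction i arbitrary: r) (auto simp: algebra_simps)

lemma present_0: "(0 < i \<Longrightarrow> 0 < \<tau> i) \<Longrightarrow> present i \<tau> 0 = i"
  by (cases i) auto

lemma arrival_time_Suc:
  "arrival_time q A (Suc n) = arrival_time q A n + (if Suc n < q then 0 else A (Suc n))"
  by (simp add: arrival_time_def)

context queue_rates
begin

text \<open>This identifies \<open>wait\<close> with the potential waiting time: the count falls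
  below \<open>m\<close> once the levels \<open>m\<close> to \<open>i\<close> have been
  passed.\<close>

lemma present_less_iff:
  assumes nonneg: "\<And>k. 0 \<le> \<tau> k" and "0 \<le> u"
  shows "present i \<tau> u < m \<longleftrightarrow> wait i \<tau> \<le> u"
  using assms(2)
proof (induction i arbitrary: u)
  case 0
  then show ?case using servers_pos by (simp add: wait_eq_0)
next
  case (Suc i)
  show ?case
  proof (cases "Suc i < m")
    case True
    then show ?thesis
      using Suc.prems Suc.IH[of "u - \<tau> (Suc i)"] by (simp add: wait_eq_0)
  next
    case False
    then show ?thesis
      using Suc.prems Suc.IH[of "u - \<tau> (Suc i)"] wait_nonneg[of \<tau> i] nonneg by (auto simp: wait_Suc)
  qed
qed

text \<open>
  \<open>state q n w\<close> is the number of jobs found by job \<open>n\<close>, with their sojourn times at each level,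
  when the interarrival times, service times and deadlines are the coordinates
  \<open>w (Inl k)\<close>, \<open>w (Inr (Inl k))\<close> and \<open>w (Inr (Inr k))\<close>.
\<close>

primrec state :: "nat \<Rightarrow> nat \<Rightarrow> (nat + nat + nat \<Rightarrow> real) \<Rightarrow> nat \<times> (nat \<Rightarrow> real)" where
  "state q 0 w = (0, \<lambda>_. 0)"
| "state q (Suc n) w =
    (let i = fst (state q n w); \<tau> = snd (state q n w);
         \<sigma> = insert_departure i (residual c (wait i \<tau>) (w (Inr (Inl n))) (w (Inr (Inr n)))) \<tau>
     in if Suc n < q then (Suc i, \<sigma>) else advance (Suc i) (w (Inl (Suc n))) \<sigma>)"

definition joined :: "nat \<Rightarrow> nat \<Rightarrow> (nat + nat + nat \<Rightarrow> real) \<Rightarrow> nat \<Rightarrow> real" where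
  "joined q n w = insert_departure (fst (state q n w))
     (residual c (wait (fst (state q n w)) (snd (state q n w))) (w (Inr (Inl n))) (w (Inr (Inr n)))) (snd (state q n w))"

lemma state_Suc:
  "state q (Suc n) w = (if Suc n < q then (Suc (fst (state q n w)), joined q n w)
     else advance (Suc (fst (state q n w))) (w (Inl (Suc n))) (joined q n w))"
  by (simp add: Let_def joined_def)

text \<open>Independence in functional form: what job \<open>n\<close> finds involves neither its
  own service time and deadline nor those of later jobs, nor later interarrival times. These
  coordinates may be resampled while the state stays fixed.\<close>

lemma state_upd [simp]:
  "n \<le> k \<Longrightarrow> state q n (w(Inr (Inl k) := x)) = state q n w"
  "n \<le> k \<Longrightarrow> state q n (w(Inr (Inr k) := x)) = state q n w"
  "n < k \<Longrightarrow> state q n (w(Inl k := x)) = state q n w"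
  by (induction n) (auto simp: Let_def)

lemma joined_upd [simp]: "n < k \<Longrightarrow> joined q n (w(Inl k := x)) = joined q n w"
  by (simp add: joined_def)

lemma fst_state_le: "fst (state q n w) \<le> n"
proof (induction n)
  case (Suc n)
  then show ?case
    using advance_le[of "Suc (fst (state q n w))" "w (Inl (Suc n))" "joined q n w"]
    by (auto simp: state_Suc simp del: state.simps advance.simps)
qed simp

lemma state_nonneg:
  assumes "\<And>e. 0 \<le> w e"
  shows "0 \<le> snd (state q n w) k" "0 \<le> joined q n w k"
proof -
  have joined: "0 \<le> joined q n w k" if "\<And>k. 0 \<le> snd (state q n w) k" for n k
    unfolding joined_def
    using that assms by (intro insert_departure_nonneg residual_nonneg wait_nonneg) auto
  show state: "0 \<le> snd (state q n w) k" for n k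
  proof (induction n arbitrary: k)
    case (Suc n)
    then show ?case
      using joined by (auto simp: state_Suc simp del: state.simps advance.simps intro: advance_nonneg)
  qed simp
  show "0 \<le> joined q n w k"
    by (rule joined) (rule state)
qed

text \<open>Since \<open>advance\<close> stops strictly inside a level, all jobs counted are still
  present at the instant of arrival. For \<open>n < q\<close> no time passes, and the top sojourn
  may have length zero.\<close>

lemma state_pos:
  assumes "q \<le> n" "0 < fst (state q n w)"
  shows "0 < snd (state q n w) (fst (state q n w))"
proof (cases n)
  case (Suc l)
  then show ?thesis
    using assms advance_pos[of "Suc (fst (state q l w))" "w (Inl (Suc l))" "joined q l w"]
    by (simp add: state_Suc del: state.simps advance.simps)
qed (use assms in auto)

section \<open>Agreement of the level description with the sample paths of the queue\<close>

context
  fixes w :: "nat + nat + nat \<Rightarrow> real" and q :: nat and a d S T :: "nat \<Rightarrow> real"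
  assumes w_nonneg: "\<And>e. 0 \<le> w e"
  defines "a \<equiv> arrival_time q (\<lambda>k. w (Inl k))"
    and "S \<equiv> \<lambda>k. w (Inr (Inl k))" and "T \<equiv> \<lambda>k. w (Inr (Inr k))"
    and "d \<equiv> departure_time c m a S T"
begin

lemma service_start_if_present:
  assumes "\<And>u. 0 \<le> u \<Longrightarrow> card {k. k < n \<and> a n + u < d k} = present (fst (state q n w)) (snd (state q n w)) u"
  shows "service_start m a d n = a n + wait (fst (state q n w)) (snd (state q n w))" (is "_ = a n + ?b")
proof -
  have "0 \<le> ?b" using w_nonneg by (intro wait_nonneg state_nonneg)
  have "service_start m a d n \<le> x \<longleftrightarrow> a n + ?b \<le> x" for x
  proof (cases "a n \<le> x")
    case True
    then show ?thesis
      using assms[of "x - a n"] present_less_iff[of "snd (state q n w)" "x - a n" "fst (state q n w)"] w_nonneg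
      by (simp add: service_start_le_iff[OF servers_pos] state_nonneg algebra_simps)
  next
    case False
    then show ?thesis
      using \<open>0 \<le> ?b\<close> by (simp add: service_start_le_iff[OF servers_pos])
  qed
  then show ?thesis by (meson order.antisym order.refl)
qed

text \<open>The hypothesis for job \<open>n\<close> gives its service start and hence its departure
  at \<open>a n\<close> plus the residual time. Inserting it raises the step function, and the gap
  until the next arrival only shifts the origin of time.\<close>

lemma card_later_eq_present:
  "0 \<le> u \<Longrightarrow> card {k. k < n \<and> a n + u < d k} = present (fst (state q n w)) (snd (state q n w)) u"
proof (induction n arbitrary: u)
  case (Suc n)
  let ?i = "fst (state q n w)" and ?\<tau> = "snd (state q n w)"
  let ?v = "residual c (wait ?i ?\<tau>) (S n) (T n)"
  have dn: "d n = a n + ?v"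
    unfolding d_def
    by (subst departure_time.simps, fold d_def)
      (simp add: Let_def service_start_if_present[OF Suc.IH] residual_def misses_deadline_shift)
  have step: "card {k. k < Suc n \<and> a n + u < d k} = present (Suc ?i) (joined q n w) u" if "0 \<le> u" for u
    using that by (simp add: card_later_Suc Suc.IH joined_def present_insert_departure dn S_def T_def del: present.simps)
  show ?case
  proof (cases "Suc n < q")
    case True
    then have "a (Suc n) = a n" by (simp add: a_def arrival_time_Suc)
    then show ?thesis
      using step[OF Suc.prems] True by (simp add: state_Suc del: state.simps present.simps)
  next
    case False
    then have an: "a (Suc n) + u = a n + (w (Inl (Suc n)) + u)" by (simp add: a_def arrival_time_Suc)
    show ?thesis
      using step[of "w (Inl (Suc n)) + u"] False Suc.prems w_nonneg unfolding an
      by (simp add: state_Suc present_advance del: state.simps advance.simps present.simps)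
  qed
qed simp

lemma jobs_found_eq: "q \<le> n \<Longrightarrow> jobs_found c m a S T n = fst (state q n w)"
  using card_later_eq_present[of 0 n] state_pos[of q n w] by (simp add: jobs_found_def d_def present_0)

lemma abandons_iff:
  "abandons c m a S T n \<longleftrightarrow> misses_deadline c (wait (fst (state q n w)) (snd (state q n w))) (S n) (T n)"
proof -
  have "service_start m a d n = a n + wait (fst (state q n w)) (snd (state q n w))"
    by (intro service_start_if_present card_later_eq_present)
  then show ?thesis
    by (simp add: abandons_def d_def[symmetric] misses_deadline_shift)
qed

end

end

section \<open>The law of the sojourn times\<close>

text \<open>The coordinate \<open>e\<close> is independent of all the others jointly. The joint law
  of the two blocks is therefore a product measure, and Fubini integrates \<open>e\<close> out with
  the others frozen.\<close>

lemma (in prob_space) nn_integral_resample: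
  assumes indep: "indep_vars (\<lambda>_. borel) X UNIV"
    and h [measurable]: "h \<in> borel_measurable (Pi\<^sub>M UNIV (\<lambda>_. borel))"
  shows "(\<integral>\<^sup>+\<omega>. h (\<lambda>j. X j \<omega>) \<partial>M) = (\<integral>\<^sup>+\<omega>. (\<integral>\<^sup>+x. h ((\<lambda>j. X j \<omega>)(e := x)) \<partial>distr M borel (X e)) \<partial>M)"
proof -
  let ?P = "Pi\<^sub>M (UNIV - {e}) (\<lambda>_. borel)" and ?Q = "Pi\<^sub>M {e} (\<lambda>_. borel)"
  let ?Y = "\<lambda>\<omega>. restrict (\<lambda>j. X j \<omega>) (UNIV - {e})" and ?Z = "\<lambda>\<omega>. restrict (\<lambda>j. X j \<omega>) {e}"
  let ?g = "\<lambda>(y, z). h (y(e := z e))"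
  have [measurable]: "X j \<in> borel_measurable M" for j
    using indep by (auto simp: indep_vars_def)
  have [measurable]: "(\<lambda>z. z e) \<in> borel_measurable ?Q"
    by (rule measurable_component_singleton) simp
  have [measurable]: "(\<lambda>p. (fst p)(e := snd p e)) \<in> measurable (?P \<Otimes>\<^sub>M ?Q) (Pi\<^sub>M UNIV (\<lambda>_. borel))"
    by (rule measurable_fun_upd[where J="UNIV - {e}"]) auto
  have g [measurable]: "?g \<in> borel_measurable (?P \<Otimes>\<^sub>M ?Q)"
    unfolding split_def by measurable
  have Y [measurable]: "?Y \<in> measurable M ?P" and Z [measurable]: "?Z \<in> measurable M ?Q"
    by (rule measurable_restrict, measurable)+
  have "indep_var ?P ?Y ?Q ?Z"
    by (rule indep_var_restrict[OF indep]) auto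
  then have prod: "distr M ?P ?Y \<Otimes>\<^sub>M distr M ?Q ?Z = distr M (?P \<Otimes>\<^sub>M ?Q) (\<lambda>\<omega>. (?Y \<omega>, ?Z \<omega>))"
    by (simp add: indep_var_distribution_eq)
  interpret L: prob_space "distr M ?Q ?Z"
    by (rule prob_space_distr) (rule Z)
  have upd_Y: "(?Y \<omega>)(e := x) = (\<lambda>j. X j \<omega>)(e := x)" for \<omega> x
    by auto
  have triv: "(\<lambda>j. X j \<omega>)(e := X e \<omega>) = (\<lambda>j. X j \<omega>)" for \<omega>
    by auto
  have hY: "(\<lambda>x. h ((?Y \<omega>)(e := x))) \<in> borel_measurable borel" for \<omega>
  proof -
    have "(\<lambda>x. (?Y \<omega>)(e := x)) \<in> measurable borel (Pi\<^sub>M UNIV (\<lambda>_. borel))"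
      by (rule measurable_PiM_single') (auto simp: space_PiM)
    then show ?thesis by (rule measurable_compose) (rule h)
  qed
  have "(\<integral>\<^sup>+\<omega>. h (\<lambda>j. X j \<omega>) \<partial>M) = (\<integral>\<^sup>+\<omega>. ?g (?Y \<omega>, ?Z \<omega>) \<partial>M)"
    by (simp only: prod.case upd_Y restrict_apply singletonI if_True triv)
  also have "\<dots> = (\<integral>\<^sup>+z. ?g z \<partial>(distr M ?P ?Y \<Otimes>\<^sub>M distr M ?Q ?Z))"
    unfolding prod by (rule nn_integral_distr[symmetric]) measurable
  also have "\<dots> = (\<integral>\<^sup>+y. (\<integral>\<^sup>+z. ?g (y, z) \<partial>distr M ?Q ?Z) \<partial>distr M ?P ?Y)"
    by (rule L.nn_integral_fst[symmetric]) measurable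
  also have "\<dots> = (\<integral>\<^sup>+\<omega>. (\<integral>\<^sup>+z. ?g (?Y \<omega>, z) \<partial>distr M ?Q ?Z) \<partial>M)"
    by (rule nn_integral_distr) measurable
  also have "\<dots> = (\<integral>\<^sup>+\<omega>. (\<integral>\<^sup>+\<omega>'. h ((?Y \<omega>)(e := X e \<omega>')) \<partial>M) \<partial>M)"
  proof (rule nn_integral_cong)
    fix \<omega> assume "\<omega> \<in> space M"
    then have [measurable]: "?Y \<omega> \<in> space ?P" by (auto simp: space_PiM)
    have "(\<integral>\<^sup>+z. ?g (?Y \<omega>, z) \<partial>distr M ?Q ?Z) = (\<integral>\<^sup>+\<omega>'. ?g (?Y \<omega>, ?Z \<omega>') \<partial>M)"
      by (rule nn_integral_distr[OF Z]) (use measurable_Pair2[OF g, of "?Y \<omega>"] in \<open>simp add: space_PiM\<close>)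
    then show "(\<integral>\<^sup>+z. ?g (?Y \<omega>, z) \<partial>distr M ?Q ?Z) = (\<integral>\<^sup>+\<omega>'. h ((?Y \<omega>)(e := X e \<omega>')) \<partial>M)"
      by simp
  qed
  also have "\<dots> = (\<integral>\<^sup>+\<omega>. (\<integral>\<^sup>+x. h ((?Y \<omega>)(e := x)) \<partial>distr M borel (X e)) \<partial>M)"
    by (intro nn_integral_cong nn_integral_distr[symmetric]) (simp_all only: measurable_distr_eq1 hY \<open>X _ \<in> borel_measurable M\<close>)
  finally show ?thesis
    by (simp only: upd_Y)
qed

lemma measurable_indicator_prod:
  fixes f :: "nat \<Rightarrow> real \<Rightarrow> ennreal"
  assumes "X \<in> measurable N (count_space UNIV)" "\<And>k. (\<lambda>w. \<sigma> w k) \<in> borel_measurable N"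
    "\<And>k. f k \<in> borel_measurable borel"
  shows "(\<lambda>w. indicator {j} (X w) * (\<Prod>k=1..l. f k (\<sigma> w k))) \<in> borel_measurable N"
  using assms
  by (intro borel_measurable_times_ennreal borel_measurable_prod_ennreal measurable_compose[OF assms(1)]
      measurable_compose[OF assms(2) assms(3)]) simp

text \<open>Allows a second coordinate to be resampled after the first.\<close>

lemma measurable_nn_integral_upd:
  assumes [measurable]: "h \<in> borel_measurable (Pi\<^sub>M UNIV (\<lambda>_. borel))" and r: "0 < r"
  shows "(\<lambda>w. \<integral>\<^sup>+x. h (w(e := x)) \<partial>exp_dist r) \<in> borel_measurable (Pi\<^sub>M UNIV (\<lambda>_. borel))"
proof -
  interpret prob_space "exp_dist r" using r by (rule prob_space_exp_dist)
  have [measurable]: "(\<lambda>(w, x). w(e := x)) \<in> measurable (Pi\<^sub>M UNIV (\<lambda>_. borel) \<Otimes>\<^sub>M borel) (Pi\<^sub>M UNIV (\<lambda>_. borel))"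
    using measurable_add_dim[of e UNIV "\<lambda>_. borel"] by simp
  show ?thesis by measurable
qed

context queue_rates
begin

lemma measurable_state [measurable]:
  shows "(\<lambda>w. fst (state q n w)) \<in> measurable (Pi\<^sub>M UNIV (\<lambda>_. borel)) (count_space UNIV)"
    and "(\<lambda>w. snd (state q n w) k) \<in> borel_measurable (Pi\<^sub>M UNIV (\<lambda>_. borel))"
    and "(\<lambda>w. joined q n w k) \<in> borel_measurable (Pi\<^sub>M UNIV (\<lambda>_. borel))"
proof -
  let ?P = "Pi\<^sub>M UNIV (\<lambda>_. borel) :: (nat + nat + nat \<Rightarrow> real) measure"
  \<comment> \<open>The recursion depth is random; measurability is checked for each of its
    countably many values.\<close>
  have joined: "(\<lambda>w. joined q n w k) \<in> borel_measurable ?P"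
    if [measurable]: "(\<lambda>w. fst (state q n w)) \<in> measurable ?P (count_space UNIV)"
      "\<And>k. (\<lambda>w. snd (state q n w) k) \<in> borel_measurable ?P" for n k
    unfolding joined_def
    by (rule measurable_compose_countable[where f="\<lambda>i w. insert_departure i
        (residual c (wait i (snd (state q n w))) (w (Inr (Inl n))) (w (Inr (Inr n)))) (snd (state q n w)) k"]) measurable
  have state: "(\<lambda>w. fst (state q n w)) \<in> measurable ?P (count_space UNIV) \<and>
      (\<forall>k. (\<lambda>w. snd (state q n w) k) \<in> borel_measurable ?P)" for n
  proof (induction n)
    case (Suc n)
    then have [measurable]: "(\<lambda>w. fst (state q n w)) \<in> measurable ?P (count_space UNIV)"
      "\<And>k. (\<lambda>w. joined q n w k) \<in> borel_measurable ?P"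
      using joined by auto
    have "(\<lambda>w. fst (advance (Suc (fst (state q n w))) (w (Inl (Suc n))) (joined q n w))) \<in> measurable ?P (count_space UNIV)"
      by (rule measurable_compose_countable[where f="\<lambda>i w. fst (advance (Suc i) (w (Inl (Suc n))) (joined q n w))"]) measurable
    moreover have "(\<lambda>w. snd (advance (Suc (fst (state q n w))) (w (Inl (Suc n))) (joined q n w)) k) \<in> borel_measurable ?P" for k
      by (rule measurable_compose_countable[where f="\<lambda>i w. snd (advance (Suc i) (w (Inl (Suc n))) (joined q n w)) k"]) measurable
    moreover have "(\<lambda>w. Suc (fst (state q n w))) \<in> measurable ?P (count_space UNIV)"
      by (rule measurable_compose_countable[where f="\<lambda>i w. Suc i"]) auto
    ultimately show ?case
      by (cases "Suc n < q") (simp_all add: state_Suc del: state.simps advance.simps)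
  qed simp
  show "(\<lambda>w. fst (state q n w)) \<in> measurable ?P (count_space UNIV)"
    "(\<lambda>w. snd (state q n w) k) \<in> borel_measurable ?P"
    using state by auto
  show "(\<lambda>w. joined q n w k) \<in> borel_measurable ?P"
    using state by (intro joined) auto
qed

end

locale queue_primitives = mmm_M_queue + fixes c :: deadline_type
begin

sublocale queue_rates c m \<mu> \<theta>
  by standard (use servers rates in auto)

abbreviation W :: "'a \<Rightarrow> nat + nat + nat \<Rightarrow> real" where
  "W \<omega> \<equiv> \<lambda>e. case_sum A (case_sum S T) e \<omega>"

lemma distr_primitives:
  "distr M borel (A k) = exp_dist lambda" "distr M borel (S k) = exp_dist \<mu>" "distr M borel (T k) = exp_dist \<theta>"
proof -
  have "distr M borel X = exp_dist r" if "distributed M lborel X (exponential_density r)" for X r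
  proof -
    have "distr M borel X = distr M lborel X" by (rule distr_cong) auto
    then show ?thesis
      using that by (simp add: distributed_distr_eq_density exp_dist_def)
  qed
  then show "distr M borel (A k) = exp_dist lambda" "distr M borel (S k) = exp_dist \<mu>" "distr M borel (T k) = exp_dist \<theta>"
    using interarrival service deadline by auto
qed

lemma measurable_primitives [measurable]:
  "A k \<in> borel_measurable M" "S k \<in> borel_measurable M" "T k \<in> borel_measurable M"
  using distributed_measurable[OF interarrival] distributed_measurable[OF service] distributed_measurable[OF deadline]
  by auto

lemma measurable_W [measurable]: "W \<in> measurable M (Pi\<^sub>M UNIV (\<lambda>_. borel))"
proof (rule measurable_PiM_single')
  show "(\<lambda>\<omega>. W \<omega> e) \<in> borel_measurable M" for e
    by (cases e rule: sum.exhaust[case_product sum.exhaust]) (auto split: sum.split)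
qed auto

lemma measurable_state_W [measurable]:
  shows "(\<lambda>\<omega>. fst (state q n (W \<omega>))) \<in> measurable M (count_space UNIV)"
    and "(\<lambda>\<omega>. snd (state q n (W \<omega>)) k) \<in> borel_measurable M"
    and "(\<lambda>\<omega>. joined q n (W \<omega>) k) \<in> borel_measurable M"
    and "(\<lambda>\<omega>. indicator {i} (fst (state q n (W \<omega>))) :: ennreal) \<in> borel_measurable M"
  by (rule measurable_compose[OF measurable_W measurable_state(1)]
      measurable_compose[OF measurable_W measurable_state(2)] measurable_compose[OF measurable_W measurable_state(3)]
      measurable_compose[OF measurable_compose[OF measurable_W measurable_state(1)]], simp?)+

lemma AE_W_nonneg: "AE \<omega> in M. \<forall>e. 0 \<le> W \<omega> e"
proof -
  have pos: "AE \<omega> in M. 0 \<le> X \<omega>" if "distr M borel X = exp_dist r" "X \<in> borel_measurable M" for X r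
  proof -
    have "AE x in distr M borel X. 0 < x"
      unfolding that(1) by (rule AE_exp_dist_pos)
    from AE_distrD[OF that(2) this] show ?thesis
      by eventually_elim simp
  qed
  have "AE \<omega> in M. 0 \<le> W \<omega> e" for e
    by (auto split: sum.split intro: pos distr_primitives)
  then show ?thesis by (simp add: AE_all_countable)
qed

lemma nn_integral_resample_arrival:
  "h \<in> borel_measurable (Pi\<^sub>M UNIV (\<lambda>_. borel)) \<Longrightarrow>
    (\<integral>\<^sup>+\<omega>. h (W \<omega>) \<partial>M) = (\<integral>\<^sup>+\<omega>. (\<integral>\<^sup>+r. h ((W \<omega>)(Inl n := r)) \<partial>exp_dist lambda) \<partial>M)"
  using nn_integral_resample[OF independent, of h "Inl n"] by (simp add: distr_primitives)

lemma nn_integral_resample_job: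
  assumes h: "h \<in> borel_measurable (Pi\<^sub>M UNIV (\<lambda>_. borel))"
  shows "(\<integral>\<^sup>+\<omega>. h (W \<omega>) \<partial>M) =
    (\<integral>\<^sup>+\<omega>. (\<integral>\<^sup>+s. (\<integral>\<^sup>+t. h ((W \<omega>)(Inr (Inl n) := s, Inr (Inr n) := t)) \<partial>exp_dist \<theta>) \<partial>exp_dist \<mu>) \<partial>M)"
  using nn_integral_resample[OF independent h, of "Inr (Inr n)"]
    nn_integral_resample[OF independent measurable_nn_integral_upd[OF h deadline_rate_pos, of "Inr (Inr n)"], of "Inr (Inl n)"]
  by (simp add: distr_primitives)

text \<open>Given what job \<open>n\<close> finds, its service time and deadline are fresh, so its
  residual time follows the hazards along the sojourn times found. The weight stays
  \<open>a\<close>, since joining does not alter the number found.\<close>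

lemma sojourn_law_joined:
  assumes law: "sojourn_law M (\<lambda>\<omega>. indicator {i} (fst (state q n (W \<omega>)))) (\<lambda>\<omega>. snd (state q n (W \<omega>))) i a"
  shows "sojourn_law M (\<lambda>\<omega>. indicator {i} (fst (state q n (W \<omega>)))) (\<lambda>\<omega>. joined q n (W \<omega>)) (Suc i) a"
  unfolding sojourn_law_def
proof (intro allI impI)
  fix f :: "nat \<Rightarrow> real \<Rightarrow> ennreal" assume "\<forall>k. f k \<in> borel_measurable borel"
  then have [measurable]: "f k \<in> borel_measurable borel" for k by simp
  let ?N = "\<lambda>\<omega>. fst (state q n (W \<omega>))" and ?\<tau> = "\<lambda>\<omega>. snd (state q n (W \<omega>))"
  have "(\<integral>\<^sup>+\<omega>. indicator {i} (?N \<omega>) * (\<Prod>k=1..Suc i. f k (joined q n (W \<omega>) k)) \<partial>M) =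
    (\<integral>\<^sup>+\<omega>. (\<integral>\<^sup>+s. (\<integral>\<^sup>+t. indicator {i} (?N \<omega>) * (\<Prod>k=1..Suc i. f k (insert_departure (?N \<omega>)
        (residual c (wait (?N \<omega>) (?\<tau> \<omega>)) s t) (?\<tau> \<omega>) k)) \<partial>exp_dist \<theta>) \<partial>exp_dist \<mu>) \<partial>M)"
    by (subst nn_integral_resample_job[where n=n],
        rule measurable_indicator_prod[where X="\<lambda>w. fst (state q n w)" and \<sigma>="joined q n"])
      (simp_all add: joined_def del: prod.cl_ivl_Suc)
  also have "\<dots> = (\<integral>\<^sup>+\<omega>. indicator {i} (?N \<omega>) * inserted f i (?\<tau> \<omega>) \<partial>M)"
  proof (rule nn_integral_cong_AE, use AE_W_nonneg in eventually_elim)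
    fix \<omega> assume "\<forall>e. 0 \<le> W \<omega> e"
    then have nonneg: "0 \<le> ?\<tau> \<omega> k" for k by (intro state_nonneg) auto
    let ?G = "\<lambda>v. \<Prod>k=1..Suc i. f k (insert_departure i v (?\<tau> \<omega>) k)"
    have G [measurable]: "?G \<in> borel_measurable borel"
      by (intro borel_measurable_prod_ennreal) measurable
    have "(\<integral>\<^sup>+s. (\<integral>\<^sup>+t. ?G (residual c (wait i (?\<tau> \<omega>)) s t) \<partial>exp_dist \<theta>) \<partial>exp_dist \<mu>) = inserted f i (?\<tau> \<omega>)"
      using nonneg
      by (simp only: nn_integral_residual[OF G wait_nonneg] hazard_integral_eq[OF _ G, symmetric]
          hazard_integral_insert_departure \<open>\<And>k. f k \<in> borel_measurable borel\<close>)
    then show "(\<integral>\<^sup>+s. (\<integral>\<^sup>+t. indicator {i} (?N \<omega>) * (\<Prod>k=1..Suc i. f k (insert_departure (?N \<omega>)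
        (residual c (wait (?N \<omega>) (?\<tau> \<omega>)) s t) (?\<tau> \<omega>) k)) \<partial>exp_dist \<theta>) \<partial>exp_dist \<mu>) =
        indicator {i} (?N \<omega>) * inserted f i (?\<tau> \<omega>)"
      by (cases "?N \<omega> = i") (simp_all del: prod.cl_ivl_Suc)
  qed
  also have "\<dots> = a * (\<Prod>k=1..Suc i. \<integral>\<^sup>+x. f k x \<partial>exp_dist (D k))"
    by (rule nn_integral_inserted[OF law]) (fact measurable_state_W \<open>\<And>k. f k \<in> borel_measurable borel\<close>)+
  finally show "(\<integral>\<^sup>+\<omega>. indicator {i} (?N \<omega>) * (\<Prod>k=1..Suc i. f k (joined q n (W \<omega>) k)) \<partial>M) = \<dots>" .
qed

text \<open>Job \<open>Suc n\<close> may find \<open>j\<close> jobs after any number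
  \<open>i\<close> found by job \<open>n\<close>, and \<open>i\<close> is at most \<open>n\<close>.
  Each such case contributes the same product of expectations, so the weights simply add up.\<close>

lemma sojourn_law_advance:
  assumes law: "\<And>i. sojourn_law M (\<lambda>\<omega>. indicator {i} (fst (state q n (W \<omega>)))) (\<lambda>\<omega>. snd (state q n (W \<omega>))) i (p i)"
    and n: "q \<le> Suc n"
  shows "sojourn_law M (\<lambda>\<omega>. indicator {j} (fst (state q (Suc n) (W \<omega>)))) (\<lambda>\<omega>. snd (state q (Suc n) (W \<omega>))) j
    (\<Sum>i\<le>n. p i * ennreal (advance_prob lambda j (Suc i)))"
  unfolding sojourn_law_def
proof (intro allI impI)
  fix f :: "nat \<Rightarrow> real \<Rightarrow> ennreal" assume "\<forall>k. f k \<in> borel_measurable borel"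
  then have [measurable]: "f k \<in> borel_measurable borel" for k by simp
  let ?N = "\<lambda>\<omega>. fst (state q n (W \<omega>))" and ?\<sigma> = "\<lambda>\<omega>. joined q n (W \<omega>)"
  have "(\<integral>\<^sup>+\<omega>. indicator {j} (fst (state q (Suc n) (W \<omega>))) * (\<Prod>k=1..j. f k (snd (state q (Suc n) (W \<omega>)) k)) \<partial>M) =
    (\<integral>\<^sup>+\<omega>. (\<integral>\<^sup>+r. indicator {j} (fst (advance (Suc (?N \<omega>)) r (?\<sigma> \<omega>))) *
       (\<Prod>k=1..j. f k (snd (advance (Suc (?N \<omega>)) r (?\<sigma> \<omega>)) k)) \<partial>exp_dist lambda) \<partial>M)"
    using n by (subst nn_integral_resample_arrival[where n="Suc n"],
        intro measurable_indicator_prod[where X="\<lambda>w. fst (state q (Suc n) w)" and \<sigma>="\<lambda>w. snd (state q (Suc n) w)"] measurable_state)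
      (simp_all add: state_Suc del: state.simps advance.simps)
  also have "\<dots> = (\<integral>\<^sup>+\<omega>. (\<Sum>i\<le>n. indicator {i} (?N \<omega>) * advanced lambda j f (Suc i) (?\<sigma> \<omega>)) \<partial>M)"
  proof (rule nn_integral_cong_AE, use AE_W_nonneg in eventually_elim)
    fix \<omega> assume "\<forall>e. 0 \<le> W \<omega> e"
    then have nonneg: "0 \<le> ?\<sigma> \<omega> k" for k by (intro state_nonneg) auto
    have "(\<integral>\<^sup>+r. indicator {j} (fst (advance (Suc (?N \<omega>)) r (?\<sigma> \<omega>))) *
       (\<Prod>k=1..j. f k (snd (advance (Suc (?N \<omega>)) r (?\<sigma> \<omega>)) k)) \<partial>exp_dist lambda) =
       advanced lambda j f (Suc (?N \<omega>)) (?\<sigma> \<omega>)"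
      using nonneg rates by (intro nn_integral_advance) auto
    also have "\<dots> = (\<Sum>i\<le>n. if i = ?N \<omega> then advanced lambda j f (Suc i) (?\<sigma> \<omega>) else 0)"
      using fst_state_le[of q n "W \<omega>"] by (subst sum.delta) auto
    also have "\<dots> = (\<Sum>i\<le>n. indicator {i} (?N \<omega>) * advanced lambda j f (Suc i) (?\<sigma> \<omega>))"
      by (intro sum.cong) (auto simp: indicator_def)
    finally show "(\<integral>\<^sup>+r. indicator {j} (fst (advance (Suc (?N \<omega>)) r (?\<sigma> \<omega>))) *
       (\<Prod>k=1..j. f k (snd (advance (Suc (?N \<omega>)) r (?\<sigma> \<omega>)) k)) \<partial>exp_dist lambda) = \<dots>" .
  qed
  also have "\<dots> = (\<Sum>i\<le>n. \<integral>\<^sup>+\<omega>. indicator {i} (?N \<omega>) * advanced lambda j f (Suc i) (?\<sigma> \<omega>) \<partial>M)"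
    using rates \<open>\<And>k. f k \<in> borel_measurable borel\<close>
    by (intro nn_integral_sum borel_measurable_times_ennreal measurable_advanced measurable_state_W) auto
  also have "\<dots> = (\<Sum>i\<le>n. p i * ennreal (advance_prob lambda j (Suc i)) * (\<Prod>k=1..j. \<integral>\<^sup>+x. f k x \<partial>exp_dist (D k)))"
    using rates by (intro sum.cong refl nn_integral_advanced[OF sojourn_law_joined[OF law]] measurable_state_W) auto
  also have "\<dots> = (\<Sum>i\<le>n. p i * ennreal (advance_prob lambda j (Suc i))) * (\<Prod>k=1..j. \<integral>\<^sup>+x. f k x \<partial>exp_dist (D k))"
    by (rule sum_distrib_right[symmetric])
  finally show "(\<integral>\<^sup>+\<omega>. indicator {j} (fst (state q (Suc n) (W \<omega>))) * (\<Prod>k=1..j. f k (snd (state q (Suc n) (W \<omega>)) k)) \<partial>M) = \<dots>" .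
qed

text \<open>Positivity of the weights makes the final conditioning meaningful. During the initial
  filling phase only \<open>i = n\<close> has positive weight; this one weight suffices to propagate
  positivity to every level after an arrival.\<close>

lemma sojourn_law_state:
  "\<exists>p. (\<forall>i. sojourn_law M (\<lambda>\<omega>. indicator {i} (fst (state q n (W \<omega>)))) (\<lambda>\<omega>. snd (state q n (W \<omega>))) i (p i)) \<and>
    (\<forall>i\<le>n. q \<le> n \<or> i = n \<longrightarrow> 0 < p i)"
proof (induction n)
  case 0
  show ?case
    by (rule exI[of _ "indicator {0}"]) (auto simp: sojourn_law_def indicator_def emeasure_space_1)
next
  case (Suc n)
  then obtain p where law: "\<And>i. sojourn_law M (\<lambda>\<omega>. indicator {i} (fst (state q n (W \<omega>)))) (\<lambda>\<omega>. snd (state q n (W \<omega>))) i (p i)"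
    and pos: "0 < p n" by auto
  show ?case
  proof (cases "Suc n < q")
    case True
    \<comment> \<open>No time passes between two initial jobs, so the number found grows by exactly
      one and the weights are shifted.\<close>
    have "sojourn_law M (\<lambda>\<omega>. indicator {i} (fst (state q (Suc n) (W \<omega>)))) (\<lambda>\<omega>. snd (state q (Suc n) (W \<omega>))) i (case_nat 0 p i)" for i
    proof (cases i)
      case 0
      then show ?thesis using True by (simp add: sojourn_law_def state_Suc del: state.simps)
    next
      case (Suc j)
      then show ?thesis
        using sojourn_law_joined[OF law, of j] True
        by (simp add: state_Suc indicator_def del: state.simps)
    qed
    with pos True show ?thesis by (intro exI[of _ "case_nat 0 p"]) auto
  next
    case False
    have "0 < (\<Sum>i\<le>n. p i * ennreal (advance_prob lambda j (Suc i)))" if "j \<le> Suc n" for j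
    proof -
      \<comment> \<open>The path on which job \<open>n\<close> finds the maximal number
        \<open>n\<close> already reaches every level \<open>j\<close> up to
        \<open>Suc n\<close>.\<close>
      have "0 < p n * ennreal (advance_prob lambda j (Suc n))"
        using pos advance_prob_pos[of lambda j "Suc n"] rates that
        by (simp add: ennreal_zero_less_mult_iff del: advance_prob.simps)
      also have "\<dots> \<le> (\<Sum>i\<le>n. p i * ennreal (advance_prob lambda j (Suc i)))"
        by (rule member_le_sum) auto
      finally show ?thesis .
    qed
    with sojourn_law_advance[OF law] False show ?thesis
      by (intro exI[of _ "\<lambda>j. \<Sum>i\<le>n. p i * ennreal (advance_prob lambda j (Suc i))"]) auto
  qed
qed

end

section \<open>Probability of meeting the deadline\<close>

context queue_rates
begin

lemma D_le: "k \<le> m \<Longrightarrow> D k = real k * \<nu>"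
  by (induction k) (auto simp: D_Suc hazard_def algebra_simps)

text \<open>For \<open>i \<ge> m\<close> the product telescopes to \<open>D m / D (Suc i)\<close>
  with \<open>D m = m * \<nu>\<close>. For \<open>i < m\<close> it is 1, and
  \<open>D (Suc i)\<close> itself is \<open>Suc i\<close> times \<open>\<nu>\<close>; the minimum
  covers both cases.\<close>

lemma prod_laplace:
  "(\<Prod>k=1..i. if m \<le> k then D k / (D k + \<theta>) else 1) = real (min (Suc i) m) * \<nu> / D (Suc i)"
proof (induction i)
  case 0
  then show ?case using servers_pos nu_pos by (simp add: D_le)
next
  case (Suc i)
  show ?case
  proof (cases "m \<le> Suc i")
    case True
    then have "D (Suc i) + \<theta> = D (Suc (Suc i))" by (simp add: D_Suc[of "Suc i"] hazard_def)
    with Suc True D_Suc_pos[of i] show ?thesis by (simp add: min_def)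
  next
    case False
    with Suc nu_pos show ?thesis by (simp add: D_le min_def)
  qed
qed

text \<open>Brings the survival probability of the wait into the product form required by
  \<open>sojourn_law\<close>.\<close>

lemma exp_wait:
  "ennreal (exp (- \<theta> * wait i \<tau>)) = (\<Prod>k=1..i. if m \<le> k then ennreal (exp (- \<theta> * \<tau> k)) else 1)"
proof (induction i)
  case 0
  then show ?case using servers_pos by (simp add: wait_eq_0)
next
  case (Suc i)
  show ?case
  proof (cases "m \<le> Suc i")
    case True
    then have "exp (- \<theta> * wait (Suc i) \<tau>) = exp (- \<theta> * wait i \<tau>) * exp (- \<theta> * \<tau> (Suc i))"
      by (simp add: wait_Suc algebra_simps flip: exp_add)
    with Suc True show ?thesis by (simp add: ennreal_mult'')
  next
    case False
    with Suc show ?thesis by (simp add: wait_eq_0)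
  qed
qed

lemma nn_integral_meets_deadline:
  assumes b: "0 \<le> b"
  shows "(\<integral>\<^sup>+s. (\<integral>\<^sup>+t. indicator {t. \<not> misses_deadline c b s t} t \<partial>exp_dist \<theta>) \<partial>exp_dist \<mu>) =
    ennreal (exp (- \<theta> * b)) * ennreal (\<mu> / \<nu>)"
proof (cases c)
  case DBS
  have "{t. \<not> misses_deadline c b s t} = {b..}" for s by (auto simp: misses_deadline_def DBS)
  moreover have "\<mu> / \<nu> = 1" unfolding \<nu>_def using service_rate_pos by (simp add: DBS)
  ultimately show ?thesis
    using service_rate_pos nn_integral_exp_dist_tail[OF deadline_rate_pos b] by (simp add: mult_ac)
next
  case DES
  have set: "{t. \<not> misses_deadline c b s t} = {b + s..}" for s by (auto simp: misses_deadline_def DES)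
  have "(\<integral>\<^sup>+s. (\<integral>\<^sup>+t. indicator {t. \<not> misses_deadline c b s t} t \<partial>exp_dist \<theta>) \<partial>exp_dist \<mu>) =
      (\<integral>\<^sup>+s. ennreal (exp (- \<theta> * b)) * (ennreal (exp (- \<theta> * s)) * 1) \<partial>exp_dist \<mu>)"
  proof (rule nn_integral_cong_AE, use AE_exp_dist_pos[of \<mu>] in eventually_elim)
    fix s :: real assume "0 < s"
    have "exp (- \<theta> * (b + s)) = exp (- \<theta> * b) * exp (- \<theta> * s)"
      by (simp add: algebra_simps flip: exp_add)
    then show "(\<integral>\<^sup>+t. indicator {t. \<not> misses_deadline c b s t} t \<partial>exp_dist \<theta>) =
        ennreal (exp (- \<theta> * b)) * (ennreal (exp (- \<theta> * s)) * 1)"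
      using nn_integral_exp_dist_tail[OF deadline_rate_pos, of "b + s"] b \<open>0 < s\<close>
      by (simp add: set ennreal_mult'')
  qed
  also have "\<dots> = ennreal (exp (- \<theta> * b)) * (\<integral>\<^sup>+s. ennreal (exp (- \<theta> * s)) * 1 \<partial>exp_dist \<mu>)"
    by (rule nn_integral_cmult) simp
  also have "(\<integral>\<^sup>+s. ennreal (exp (- \<theta> * s)) * 1 \<partial>exp_dist \<mu>) = ennreal (\<mu> / (\<mu> + \<theta>))"
    using service_rate_pos deadline_rate_pos by (subst nn_integral_exp_dist_tilt) auto
  also have "\<mu> + \<theta> = \<nu>" unfolding \<nu>_def by (simp add: DES)
  finally show ?thesis .
qed

text \<open>The rate \<open>\<nu>\<close> cancels, leaving the rate of service completions divided
  by the total death rate at level \<open>i + 1\<close>.\<close>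

lemma laplace_times_service:
  "(\<mu> / \<nu>) * (\<Prod>k=1..i. if m \<le> k then D k / (D k + \<theta>) else 1) = 1 - abandonment_rate c m \<theta> (Suc i) / D (Suc i)"
proof -
  have "(\<mu> / \<nu>) * (\<Prod>k=1..i. if m \<le> k then D k / (D k + \<theta>) else 1) = real (min (Suc i) m) * \<mu> / D (Suc i)"
    unfolding prod_laplace using nu_pos by simp
  also have "real (min (Suc i) m) * \<mu> = D (Suc i) - abandonment_rate c m \<theta> (Suc i)"
    by (simp add: death_rate_def)
  finally show ?thesis
    using D_Suc_pos[of i] by (simp add: diff_divide_distrib)
qed

end

context queue_primitives
begin

lemma emeasure_meets_deadline:
  assumes law: "sojourn_law M (\<lambda>\<omega>. indicator {i} (fst (state q n (W \<omega>)))) (\<lambda>\<omega>. snd (state q n (W \<omega>))) i p"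
  shows "(\<integral>\<^sup>+\<omega>. indicator {i} (fst (state q n (W \<omega>))) * indicator {t. \<not> misses_deadline c
      (wait (fst (state q n (W \<omega>))) (snd (state q n (W \<omega>)))) (S n \<omega>) t} (T n \<omega>) \<partial>M) =
    p * ennreal (1 - abandonment_rate c m \<theta> (Suc i) / D (Suc i))"
proof -
  let ?N = "\<lambda>\<omega>. fst (state q n (W \<omega>))" and ?\<tau> = "\<lambda>\<omega>. snd (state q n (W \<omega>))"
  let ?P = "Pi\<^sub>M UNIV (\<lambda>_. borel) :: (nat + nat + nat \<Rightarrow> real) measure"
  \<comment> \<open>The wait is taken at the fixed level \<open>i\<close>; under the indicator this
    is the wait at the number actually found.\<close>
  define h :: "(nat + nat + nat \<Rightarrow> real) \<Rightarrow> ennreal" where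
    "h w = indicator {i} (fst (state q n w)) * indicator {t. \<not> misses_deadline c
      (wait i (snd (state q n w))) (w (Inr (Inl n))) t} (w (Inr (Inr n)))" for w
  define f :: "nat \<Rightarrow> real \<Rightarrow> ennreal" where
    "f k x = (if m \<le> k then ennreal (exp (- \<theta> * x)) else 1)" for k x
  have [measurable]: "f k \<in> borel_measurable borel" for k
    unfolding f_def by (cases "m \<le> k") simp_all
  have h: "h \<in> borel_measurable ?P"
  proof -
    have 1: "(\<lambda>w. indicator {i} (fst (state q n w)) :: ennreal) \<in> borel_measurable ?P"
      by (rule measurable_compose[OF measurable_state(1)]) simp
    have [measurable]: "(\<lambda>w. wait i (snd (state q n w))) \<in> borel_measurable ?P"
      by (intro measurable_wait measurable_state)
    have 2: "(\<lambda>w. if \<not> misses_deadline c (wait i (snd (state q n w))) (w (Inr (Inl n))) (w (Inr (Inr n)))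
        then 1 else 0 :: ennreal) \<in> borel_measurable ?P"
      by measurable
    have "h = (\<lambda>w. indicator {i} (fst (state q n w)) *
        (if \<not> misses_deadline c (wait i (snd (state q n w))) (w (Inr (Inl n))) (w (Inr (Inr n))) then 1 else 0))"
      by (auto simp: h_def indicator_def fun_eq_iff)
    then show ?thesis
      using borel_measurable_times_ennreal[OF 1 2] by simp
  qed
  have "(\<integral>\<^sup>+\<omega>. indicator {i} (?N \<omega>) * indicator {t. \<not> misses_deadline c (wait (?N \<omega>) (?\<tau> \<omega>)) (S n \<omega>) t} (T n \<omega>) \<partial>M) =
      (\<integral>\<^sup>+\<omega>. h (W \<omega>) \<partial>M)"
    by (intro nn_integral_cong) (auto simp: h_def indicator_def)
  also have "\<dots> = (\<integral>\<^sup>+\<omega>. (\<integral>\<^sup>+s. (\<integral>\<^sup>+t. indicator {i} (?N \<omega>) *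
      indicator {t. \<not> misses_deadline c (wait i (?\<tau> \<omega>)) s t} t \<partial>exp_dist \<theta>) \<partial>exp_dist \<mu>) \<partial>M)"
    by (subst nn_integral_resample_job[OF h, of n]) (simp add: h_def)
  also have "\<dots> = (\<integral>\<^sup>+\<omega>. ennreal (\<mu> / \<nu>) * (indicator {i} (?N \<omega>) * (\<Prod>k=1..i. f k (?\<tau> \<omega> k))) \<partial>M)"
  proof (rule nn_integral_cong_AE, use AE_W_nonneg in eventually_elim)
    fix \<omega> assume "\<forall>e. 0 \<le> W \<omega> e"
    then have b: "0 \<le> wait i (?\<tau> \<omega>)" by (intro wait_nonneg state_nonneg) auto
    show "(\<integral>\<^sup>+s. (\<integral>\<^sup>+t. indicator {i} (?N \<omega>) *
        indicator {t. \<not> misses_deadline c (wait i (?\<tau> \<omega>)) s t} t \<partial>exp_dist \<theta>) \<partial>exp_dist \<mu>) =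
        ennreal (\<mu> / \<nu>) * (indicator {i} (?N \<omega>) * (\<Prod>k=1..i. f k (?\<tau> \<omega> k)))"
      unfolding f_def exp_wait[symmetric] using nn_integral_meets_deadline[OF b]
      by (cases "?N \<omega> = i") (simp_all add: mult_ac)
  qed
  also have "\<dots> = ennreal (\<mu> / \<nu>) * (\<integral>\<^sup>+\<omega>. indicator {i} (?N \<omega>) * (\<Prod>k=1..i. f k (?\<tau> \<omega> k)) \<partial>M)"
    by (intro nn_integral_cmult measurable_indicator_prod measurable_state_W) measurable
  also have "\<dots> = ennreal (\<mu> / \<nu>) * (p * (\<Prod>k=1..i. \<integral>\<^sup>+x. f k x \<partial>exp_dist (D k)))"
    by (subst sojourn_lawD[OF law]) simp_all
  also have "(\<Prod>k=1..i. \<integral>\<^sup>+x. f k x \<partial>exp_dist (D k)) = (\<Prod>k=1..i. ennreal (if m \<le> k then D k / (D k + \<theta>) else 1))"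
  proof (rule prod.cong[OF refl])
    fix k assume "k \<in> {1..i}"
    then have "0 < D k" by (intro D_pos) auto
    then show "(\<integral>\<^sup>+x. f k x \<partial>exp_dist (D k)) = ennreal (if m \<le> k then D k / (D k + \<theta>) else 1)"
      using nn_integral_exp_dist_tilt[of "\<lambda>_. 1" "D k" \<theta>] deadline_rate_pos by (simp add: f_def)
  qed
  also have "\<dots> = ennreal (\<Prod>k=1..i. if m \<le> k then D k / (D k + \<theta>) else 1)"
    using D_nonneg deadline_rate_pos by (intro prod_ennreal) (auto intro!: divide_nonneg_nonneg add_nonneg_nonneg)
  also have "ennreal (\<mu> / \<nu>) * (p * \<dots>) = p * ennreal ((\<mu> / \<nu>) * (\<Prod>k=1..i. if m \<le> k then D k / (D k + \<theta>) else 1))"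
    using service_rate_pos nu_pos by (subst ennreal_mult') (simp_all add: mult_ac less_imp_le)
  finally show ?thesis
    unfolding laplace_times_service .
qed

lemma p_ab_eq:
  assumes "q \<le> n" "i \<le> n"
  shows "p_ab c q n i = abandonment_rate c m \<theta> (Suc i) / D (Suc i)"
proof -
  let ?r = "abandonment_rate c m \<theta> (Suc i) / D (Suc i)"
  let ?ab = "\<lambda>\<omega>. abandons c m (arrival_time q (\<lambda>k. A k \<omega>)) (\<lambda>k. S k \<omega>) (\<lambda>k. T k \<omega>) n"
  let ?found = "\<lambda>\<omega>. jobs_found c m (arrival_time q (\<lambda>k. A k \<omega>)) (\<lambda>k. S k \<omega>) (\<lambda>k. T k \<omega>) n = i"
  obtain p where law: "sojourn_law M (\<lambda>\<omega>. indicator {i} (fst (state q n (W \<omega>)))) (\<lambda>\<omega>. snd (state q n (W \<omega>))) i p"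
    and pos: "0 < p"
    using sojourn_law_state[of q n] assms by blast
  have [measurable]: "Measurable.pred M ?ab"
    using servers by (intro pred_abandons) measurable
  have [measurable]: "Measurable.pred M ?found"
    using servers by (intro pred_jobs_found) measurable
  \<comment> \<open>The product formula computes the probability \<open>R\<close> of meeting the
    deadline; abandonment is obtained as the complement of \<open>R\<close> in
    \<open>F\<close>.\<close>
  define F where "F = {\<omega> \<in> space M. ?found \<omega>}"
  define R where "R = {\<omega> \<in> space M. ?found \<omega> \<and> \<not> ?ab \<omega>}"
  have [measurable]: "F \<in> sets M" "R \<in> sets M"
    unfolding F_def R_def by measurable
  have found: "?found \<omega> \<longleftrightarrow> fst (state q n (W \<omega>)) = i"
    and ab: "?ab \<omega> \<longleftrightarrow> misses_deadline c (wait (fst (state q n (W \<omega>))) (snd (state q n (W \<omega>)))) (S n \<omega>) (T n \<omega>)"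
    if "\<forall>e. 0 \<le> W \<omega> e" for \<omega>
    using jobs_found_eq[of "W \<omega>" q n] abandons_iff[of "W \<omega>" q n] that assms(1) by simp_all
  have "emeasure M F = (\<integral>\<^sup>+\<omega>. indicator {i} (fst (state q n (W \<omega>))) \<partial>M)"
    unfolding nn_integral_indicator[OF \<open>F \<in> sets M\<close>, symmetric]
    by (rule nn_integral_cong_AE, use AE_W_nonneg AE_space in eventually_elim)
      (auto simp: F_def indicator_def found)
  also have "\<dots> = p"
    using sojourn_lawD[OF law, of "\<lambda>_ _. 1"] D_pos by simp
  finally have F: "emeasure M F = p" .
  have "emeasure M R = (\<integral>\<^sup>+\<omega>. indicator {i} (fst (state q n (W \<omega>))) * indicator {t. \<not> misses_deadline c
      (wait (fst (state q n (W \<omega>))) (snd (state q n (W \<omega>)))) (S n \<omega>) t} (T n \<omega>) \<partial>M)"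
    unfolding nn_integral_indicator[OF \<open>R \<in> sets M\<close>, symmetric]
    by (rule nn_integral_cong_AE, use AE_W_nonneg AE_space in eventually_elim)
      (auto simp: R_def indicator_def found ab)
  then have R: "emeasure M R = p * ennreal (1 - ?r)"
    using emeasure_meets_deadline[OF law] by simp
  \<comment> \<open>\<open>ennreal\<close> truncates negative numbers to 0, so the sign is needed to
    return to real probabilities.\<close>
  have "0 \<le> 1 - ?r"
    unfolding laplace_times_service[of i, symmetric] using D_nonneg deadline_rate_pos service_rate_pos nu_pos
    by (intro mult_nonneg_nonneg prod_nonneg) (auto intro!: divide_nonneg_nonneg add_nonneg_nonneg simp: less_imp_le)
  then have "prob R = prob F * (1 - ?r)"
    using R unfolding F[symmetric] emeasure_eq_measure by (simp flip: ennreal_mult)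
  moreover have "0 < prob F"
    using pos unfolding F[symmetric] emeasure_eq_measure by simp
  moreover have "{\<omega> \<in> space M. ?ab \<omega> \<and> ?found \<omega>} = F - R"
    by (auto simp: F_def R_def)
  moreover have "prob (F - R) = prob F - prob R"
    by (rule finite_measure_Diff) (auto simp: F_def R_def)
  ultimately show ?thesis
    unfolding p_ab_def cond_prob_def F_def[symmetric] by (simp add: field_simps)
qed

end

theorem proposition2:
  fixes M :: "'a measure" and lambda \<mu> \<theta> :: real and m :: nat
    and A S T :: "nat \<Rightarrow> 'a \<Rightarrow> real"
    and c :: deadline_type and q n i :: nat
  assumes "mmm_M_queue M lambda \<mu> \<theta> m A S T"
    and "q \<le> n" and "i \<le> n"
  shows "mmm_M_queue.p_ab M m A S T c q n i
           = abandonment_rate c m \<theta> (i + 1) / death_rate c m \<mu> \<theta> (i + 1)"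
proof -
  interpret mmm_M_queue M lambda \<mu> \<theta> m A S T by fact
  interpret queue_primitives M lambda \<mu> \<theta> m A S T c by unfold_locales
  show ?thesis
    using p_ab_eq[OF assms(2,3)] by simp
qed

end
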